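(* Let $(X,f:X\to\mathcal{P}(\mathcal{D}X\times A))$ be a simple Segala system, where $A$ contains a distinguished action $\tau$. Then an equivalence relation $E\subseteq X\times X$ is a weak probabilistic bisimulation on $(X,f)$ if and only if $E$ is a $B$-$\sqcup$-bisimulation on the $\mathbb{C}$-coalgebra $(X,\kappa_X\circ f:X\to C_0M(X\times A))$, where $B$ is the weak observation pattern.
   Context: $\mathcal{D}X$: finitely supported $\xi:X\to[0,\infty)$ with $\sum_x\xi(x)=1$; $\delta_x$ point mass; operations on valuations pointwise. Write $x\xrightarrow{a}\xi$ iff $(\xi,a)\in f(x)$; a combined step $x\overset{a}{\rightsquigarrow}\xi$ means finitely many $x\xrightarrow{a}\xi_i$, $r_i\ge0$, $\sum r_i=1$, $\xi=\sum r_i\xi_i$. Weak transitions: $x\overset{a}{\Rightarrow}_0\xi$ iff $a=\tau$ and $\xi=\delta_x$; $x\overset{a}{\Rightarrow}_{n+1}\xi$ iff $\xi=\sum_y\big(p\,\zeta_a(y)\theta^\tau_y+(1-p)\zeta_\tau(y)\theta^a_y\big)$ with $p\in[0,1]$, $x\overset{a}{\rightsquigarrow}\zeta_a$, $x\overset{\tau}{\rightsquigarrow}\zeta_\tau$, $y\overset{a}{\Rightarrow}_n\theta^a_y$, $y\overset{\tau}{\Rightarrow}_n\theta^\tau_y$ for all $y$ ($\theta^a=\theta^\tau$ if $a=\tau$). $E$ is a weak probabilistic bisimulation if whenever $xEy$ and $x\xrightarrow{a}\xi$ there are $n,\xi'$ with $y\overset{a}{\Rightarrow}_n\xi'$ and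 $\sum_{z\in C}\xi(z)=\sum_{z\in C}\xi'(z)$ for all $E$-classes $C$. The monad $\mathbb{C}$: $C_0MY$ is the set of nonempty sets $M$ of finitely supported maps $Y\to[0,\infty)$ with $\sum_ip_i\xi_i\in M$ whenever finitely many $\xi_i\in M$, $p_i\ge0$, $\sum p_i\le1$; $\eta(y)=\{r\delta_y\mid r\in[0,1]\}$; for $g:Y\to C_0MZ$, $g^\dagger(S)=\{\sum_{y}\zeta(y)\theta_y\mid\zeta\in S,\ \theta_y\in g(y)\ \text{for all }y\}$. $C_0MY$ is ordered by inclusion (maps into it pointwise), with least element $\{0\}$; $M\sqcup N$ is the least element of $C_0MY$ containing $M\cup N$. $\kappa_X(S)=\{\lambda(x,a).\sum_ir_i\delta_{a,a_i}\xi_i(x)\mid$ finitely many $(\xi_i,a_i)\in S$, $r_i\ge0$, $\sum r_i\le1\}$, $\delta_{a,a'}=1$ iff $a=a'$ else $0$. The weak pattern is $B=\{\tau^*\}\cup\{\tau^*a\tau^*\mid a\in A\setminus\{\tau\}\}\cup\{\emptyset\}$, with derivatives $b/a=\{w\mid aw\in b\}$. For $h:X\to Y$ and coalgebra $k:X\to C_0M(X\times A)$, $k^B_h:X\to(C_0MY)^B$ is the least map with $k^B_h(x)(b)=e_b(x)\sqcup(\lambda(y,a).k^B_h(y)(b/a))^\dagger(k(x))$, $e_b(x)=\eta(h(x))$ if $\epsilon\in b$ and $\{0\}$ otherwise. $E$ is a $B$-$\sqcup$-bisimulation on $(X,k)$ if $k^B_\pi(x)=k^B_\pi(x')$ whenever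 $xEx'$, where $\pi:X\to X/E$ is the projection.
   Formalization: As written the equivalence fails; here the answering weak transitions may also idle (every state gets an extra silent step to its own point mass, allowing early halting), and the components ζ and θ_y are required only where their coefficient is nonzero. *)

theory Defs
  imports Complex_Main "HOL-Library.FuncSet" "HOL-Library.Groups_Big_Fun"
begin

text \<open>
  The state space and the action set are types. A valuation on a set \<open>Y\<close> is a real function
  on the ambient type that vanishes outside \<open>Y\<close>. Sums over all points are written with
  \<^const>\<open>Sum_any\<close>, which sums over the points where the summand is nonzero.
\<close>

definition valuations :: "'y set \<Rightarrow> ('y \<Rightarrow> real) set" where
  "valuations Y = {\<xi>. finite {y. \<xi> y \<noteq> 0} \<and> {y. \<xi> y \<noteq> 0} \<subseteq> Y \<and> (\<forall>y. 0 \<le> \<xi> y)}"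

definition dists :: "('x \<Rightarrow> real) set" where
  "dists = {\<xi> \<in> valuations UNIV. Sum_any \<xi> = 1}"

definition dirac :: "'y \<Rightarrow> 'y \<Rightarrow> real" where
  "dirac y = (\<lambda>z. if z = y then 1 else 0)"

definition mass :: "('x \<Rightarrow> real) \<Rightarrow> 'x set \<Rightarrow> real" where
  "mass \<xi> C = Sum_any (\<lambda>z. if z \<in> C then \<xi> z else 0)"


type_synonym ('x, 'a) segala = "'x \<Rightarrow> (('x \<Rightarrow> real) \<times> 'a) set"

definition segala_system :: "('x, 'a) segala \<Rightarrow> bool" where
  "segala_system f \<longleftrightarrow> (\<forall>x. f x \<subseteq> dists \<times> UNIV)"

definition combined_step :: "('x, 'a) segala \<Rightarrow> 'x \<Rightarrow> 'a \<Rightarrow> ('x \<Rightarrow> real) \<Rightarrow> bool" where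
  "combined_step f x a \<xi> \<longleftrightarrow>
     (\<exists>(n::nat) r \<xi>s. (\<forall>i<n. (\<xi>s i, a) \<in> f x \<and> 0 \<le> r i) \<and> (\<Sum>i<n. r i) = 1 \<and>
        \<xi> = (\<lambda>z. \<Sum>i<n. r i * \<xi>s i z))"

text \<open>
  A component of the sum is only required to exist if it occurs with a nonzero coefficient.
  Otherwise there would be no weak transition for a visible action at all, since no state has
  one at level \<open>0\<close>.
\<close>

primrec weak_trans ::
    "'a \<Rightarrow> ('x, 'a) segala \<Rightarrow> nat \<Rightarrow> 'x \<Rightarrow> 'a \<Rightarrow> ('x \<Rightarrow> real) \<Rightarrow> bool" where
  "weak_trans \<tau> f 0 = (\<lambda>x a \<xi>. a = \<tau> \<and> \<xi> = dirac x)"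
| "weak_trans \<tau> f (Suc n) = (\<lambda>x a \<xi>. \<exists>p \<zeta>a \<zeta>\<tau> \<theta>a \<theta>\<tau>. 0 \<le> p \<and> p \<le> 1 \<and>
     (p \<noteq> 0 \<longrightarrow> combined_step f x a \<zeta>a) \<and>
     (1 - p \<noteq> 0 \<longrightarrow> combined_step f x \<tau> \<zeta>\<tau>) \<and>
     (\<forall>y. p * \<zeta>a y \<noteq> 0 \<longrightarrow> weak_trans \<tau> f n y \<tau> (\<theta>\<tau> y)) \<and>
     (\<forall>y. (1 - p) * \<zeta>\<tau> y \<noteq> 0 \<longrightarrow> weak_trans \<tau> f n y a (\<theta>a y)) \<and>
     (a = \<tau> \<longrightarrow> \<theta>a = \<theta>\<tau>) \<and>
     \<xi> = (\<lambda>z. Sum_any (\<lambda>y. p * \<zeta>a y * \<theta>\<tau> y z + (1 - p) * \<zeta>\<tau> y * \<theta>a y z)))"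

text \<open>
  The recursion above makes all branches perform the same number of steps. A weak transition in
  the usual sense may halt at any time, at different depths on different branches and with some
  probability; so may the observations below, where the word \<open>\<epsilon>\<close> belongs to \<open>\<tau>\<^sup>*\<close>.
  Halting is obtained by letting every state idle with a silent step. Without it, the two kinds
  of bisimulation do not coincide.
\<close>

definition idle :: "'a \<Rightarrow> ('x, 'a) segala \<Rightarrow> ('x, 'a) segala" where
  "idle \<tau> f = (\<lambda>x. insert (dirac x, \<tau>) (f x))"

definition weak_prob_bisim :: "'a \<Rightarrow> ('x, 'a) segala \<Rightarrow> ('x \<times> 'x) set \<Rightarrow> bool" where
  "weak_prob_bisim \<tau> f E \<longleftrightarrow>
     (\<forall>x y a \<xi>. (x, y) \<in> E \<longrightarrow> (\<xi>, a) \<in> f x \<longrightarrow>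
        (\<exists>n \<xi>'. weak_trans \<tau> (idle \<tau> f) n y a \<xi>' \<and> (\<forall>C \<in> UNIV // E. mass \<xi> C = mass \<xi>' C)))"


definition C0M :: "'y set \<Rightarrow> ('y \<Rightarrow> real) set set" where
  "C0M Y = {M. M \<noteq> {} \<and> M \<subseteq> valuations Y \<and>
     (\<forall>(n::nat) p \<xi>. (\<forall>i<n. \<xi> i \<in> M \<and> 0 \<le> p i) \<and> (\<Sum>i<n. p i) \<le> 1 \<longrightarrow>
        (\<lambda>y. \<Sum>i<n. p i * \<xi> i y) \<in> M)}"

definition C_unit :: "'y \<Rightarrow> ('y \<Rightarrow> real) set" where
  "C_unit y = {\<lambda>z. r * dirac y z | r. 0 \<le> r \<and> r \<le> 1}"

definition C_ext :: "('y \<Rightarrow> ('z \<Rightarrow> real) set) \<Rightarrow> ('y \<Rightarrow> real) set \<Rightarrow> ('z \<Rightarrow> real) set" where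
  "C_ext g S = {\<lambda>z. Sum_any (\<lambda>y. \<zeta> y * \<theta> y z) | \<zeta> \<theta>. \<zeta> \<in> S \<and> (\<forall>y. \<theta> y \<in> g y)}"

definition C_join :: "'y set \<Rightarrow> ('y \<Rightarrow> real) set \<Rightarrow> ('y \<Rightarrow> real) set \<Rightarrow> ('y \<Rightarrow> real) set" where
  "C_join Y M N = (LEAST K. K \<in> C0M Y \<and> M \<union> N \<subseteq> K)"

definition kappa :: "(('x \<Rightarrow> real) \<times> 'a) set \<Rightarrow> ('x \<times> 'a \<Rightarrow> real) set" where
  "kappa S = {\<lambda>(x, a). \<Sum>i<n. r i * (if a = as i then 1 else 0) * \<xi>s i x | (n::nat) r \<xi>s as.
     (\<forall>i<n. (\<xi>s i, as i) \<in> S \<and> 0 \<le> r i) \<and> (\<Sum>i<n. r i) \<le> 1}"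


definition weak_pattern :: "'a \<Rightarrow> 'a list set set" where
  "weak_pattern \<tau> =
     {lists {\<tau>}} \<union>
     {{u @ [a] @ v | u v. u \<in> lists {\<tau>} \<and> v \<in> lists {\<tau>}} | a. a \<noteq> \<tau>} \<union>
     {{}}"

definition lang_quot :: "'a list set \<Rightarrow> 'a \<Rightarrow> 'a list set" where
  "lang_quot b a = {w. a # w \<in> b}"

definition obs_init :: "('x \<Rightarrow> 'y) \<Rightarrow> 'a list set \<Rightarrow> 'x \<Rightarrow> ('y \<Rightarrow> real) set" where
  "obs_init h b x = (if [] \<in> b then C_unit (h x) else {\<lambda>_. 0})"

text \<open>
  The exponent \<open>(C0M Y)\<^sup>B\<close> is the extensional function space, so that the order on total
  functions restricts to the pointwise order on maps from \<open>B\<close>.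
\<close>

definition obs_map :: "'a list set set \<Rightarrow> 'y set \<Rightarrow> ('x \<Rightarrow> 'y) \<Rightarrow> ('x \<Rightarrow> ('x \<times> 'a \<Rightarrow> real) set) \<Rightarrow>
    'x \<Rightarrow> 'a list set \<Rightarrow> ('y \<Rightarrow> real) set" where
  "obs_map B Y h k = (LEAST K. (\<forall>x. K x \<in> B \<rightarrow>\<^sub>E C0M Y) \<and>
     (\<forall>x. \<forall>b\<in>B. K x b =
        C_join Y (obs_init h b x) (C_ext (\<lambda>(y, a). K y (lang_quot b a)) (k x))))"

definition obs_bisim ::
    "'a list set set \<Rightarrow> ('x \<Rightarrow> ('x \<times> 'a \<Rightarrow> real) set) \<Rightarrow> ('x \<times> 'x) set \<Rightarrow> bool" where
  "obs_bisim B k E \<longleftrightarrow>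
     (\<forall>x x'. (x, x') \<in> E \<longrightarrow>
        obs_map B (UNIV // E) (\<lambda>x. E `` {x}) k x = obs_map B (UNIV // E) (\<lambda>x. E `` {x}) k x')"

end

theory Submission
  imports Defs "HOL-Library.Function_Algebras" "HOL-Analysis.Convex"
begin

text \<open>
  The least map \<open>k\<^sup>B\<^sub>h\<close> consists of the observations generated by \<open>0\<close>, by halting when \<open>\<epsilon> \<in> b\<close>,
  by performing one step, and by convex combination.

  A weak bisimulation preserves observations, by induction on their generation: a step \<open>x \<rightarrow> \<xi>\<close>
  followed by a kernel \<open>\<theta>\<close> is answered by a weak transition \<open>y \<Rightarrow> \<xi>'\<close> with the same image in \<open>X/E\<close>,
  followed by the conditional expectation of \<open>\<theta>\<close> given the class; and since \<open>b/\<tau> = b\<close> for every \<open>b\<close>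
  in the weak pattern, prefixing a weak transition to observations yields an observation again.

  Conversely, all observations have total mass at most \<open>1\<close>. An observation of mass exactly \<open>1\<close> can
  lose nothing along its generation, hence it is the image in \<open>X/E\<close> of a weak transition. This
  uses that the weak transitions of a fixed length form a convex set, and that idling brings
  finitely many of them to a common length. The image of a step \<open>x \<rightarrow> \<xi>\<close> has mass \<open>1\<close>, so every
  \<open>y\<close> with the same observations answers it.
\<close>

section \<open>Functions as vectors\<close>

instantiation "fun" :: (type, real_vector) real_vector
begin

definition scaleR_fun :: "real \<Rightarrow> ('a \<Rightarrow> 'b) \<Rightarrow> 'a \<Rightarrow> 'b" where
  "scaleR_fun r f = (\<lambda>x. r *\<^sub>R f x)"

instance
  by standard (simp_all add: scaleR_fun_def fun_eq_iff scaleR_add_left scaleR_add_right)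

end

lemma scaleR_fun_apply [simp]: "(r *\<^sub>R f) x = r *\<^sub>R f x"
  by (simp add: scaleR_fun_def)

lemma sum_fun_apply: "(\<Sum>i\<in>I. f i) x = (\<Sum>i\<in>I. f i x)"
  by (induction I rule: infinite_finite_induct) auto

lemma sum_scaleR_fun_eq:
  fixes f :: "'i \<Rightarrow> 'a \<Rightarrow> real"
  shows "(\<Sum>i\<in>I. r i *\<^sub>R f i) = (\<lambda>x. \<Sum>i\<in>I. r i * f i x)"
  by (simp add: fun_eq_iff sum_fun_apply)

section \<open>Convex combinations\<close>

lemma convex_sum_le_one:
  assumes "finite I" "convex M" "0 \<in> M"
    and "\<And>i. i \<in> I \<Longrightarrow> 0 \<le> r i" "sum r I \<le> 1" "\<And>i. i \<in> I \<Longrightarrow> x i \<in> M"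
  shows "(\<Sum>i\<in>I. r i *\<^sub>R x i) \<in> M"
proof (cases "sum r I = 0")
  case True
  then have "r i = 0" if "i \<in> I" for i
    using that assms(1,4) sum_nonneg_eq_0_iff by blast
  then show ?thesis
    using assms(3) by simp
next
  case False
  let ?s = "sum r I"
  have pos: "0 < ?s"
    using False assms(4) sum_nonneg[of I r] by force
  have "(\<Sum>i\<in>I. (r i / ?s) *\<^sub>R x i) \<in> M"
    using assms pos by (intro convex_sum) (auto simp: sum_divide_distrib[symmetric])
  then have "?s *\<^sub>R (\<Sum>i\<in>I. (r i / ?s) *\<^sub>R x i) + (1 - ?s) *\<^sub>R 0 \<in> M"
    using pos assms by (intro convexD) auto
  then show ?thesis
    using pos by (simp add: scaleR_sum_right)
qed

lemma convex_weighted_mean: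
  assumes "convex M" "0 \<le> r" "0 \<le> s" "r \<noteq> 0 \<Longrightarrow> x \<in> M" "s \<noteq> 0 \<Longrightarrow> y \<in> M"
  obtains z where "r *\<^sub>R x + s *\<^sub>R y = (r + s) *\<^sub>R z" "r + s \<noteq> 0 \<Longrightarrow> z \<in> M"
proof
  let ?z = "if r = 0 then y else if s = 0 then x else (r / (r + s)) *\<^sub>R x + (s / (r + s)) *\<^sub>R y"
  show "r *\<^sub>R x + s *\<^sub>R y = (r + s) *\<^sub>R ?z"
    using assms(2,3) by (simp add: scaleR_add_right)
  show "?z \<in> M" if "r + s \<noteq> 0"
    using that assms mem_convex_alt[OF assms(1), of x y r s] by auto
qed

lemma convex_hull_indexed_lessThan:
  fixes S :: "'v::real_vector set"
  shows "convex hull S = {v. \<exists>(n::nat) r x. (\<forall>i<n. x i \<in> S \<and> 0 \<le> r i) \<and> (\<Sum>i<n. r i) = 1 \<and>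
    v = (\<Sum>i<n. r i *\<^sub>R x i)}" (is "_ = ?combinations")
proof
  show "convex hull S \<subseteq> ?combinations"
  proof
    fix v assume "v \<in> convex hull S"
    then obtain n r x where "\<forall>i\<in>{1::nat..n}. 0 \<le> r i \<and> x i \<in> S" "sum r {1..n} = 1"
      "(\<Sum>i = 1..n. r i *\<^sub>R x i) = v"
      unfolding convex_hull_indexed by auto
    then show "v \<in> ?combinations"
      by (intro CollectI exI[of _ n] exI[of _ "\<lambda>i. r (Suc i)"] exI[of _ "\<lambda>i. x (Suc i)"])
        (auto simp: sum.atLeast1_atMost_eq)
  qed
  show "?combinations \<subseteq> convex hull S"
    by (safe, rule convex_sum[OF _ convex_convex_hull]) (auto intro: hull_inc)
qed

lemma convex_combination_eq_upper_boundD: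
  fixes x y c s t :: real
  assumes "s * x + t * y = c" "s + t = 1" "0 < s" "0 < t" "x \<le> c" "y \<le> c"
  shows "x = c" "y = c"
proof -
  have "s * (c - x) + t * (c - y) = (s + t) * c - (s * x + t * y)"
    by (simp add: algebra_simps)
  also have "\<dots> = 0"
    using assms(1,2) by simp
  finally show "x = c" "y = c"
    using assms(3-6) by (auto simp: add_nonneg_eq_0_iff)
qed

section \<open>Finitely supported functions\<close>

definition supp :: "('y \<Rightarrow> real) \<Rightarrow> 'y set" where
  "supp \<xi> = {y. \<xi> y \<noteq> 0}"

definition bind :: "('y \<Rightarrow> real) \<Rightarrow> ('y \<Rightarrow> 'v) \<Rightarrow> 'v::real_vector" where
  "bind \<xi> \<theta> = (\<Sum>y\<in>supp \<xi>. \<xi> y *\<^sub>R \<theta> y)"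

definition pushforward :: "('x \<Rightarrow> 'y) \<Rightarrow> ('x \<Rightarrow> real) \<Rightarrow> 'y \<Rightarrow> real" where
  "pushforward h \<xi> = bind \<xi> (\<lambda>x. dirac (h x))"

lemma in_supp_iff: "y \<in> supp \<xi> \<longleftrightarrow> \<xi> y \<noteq> 0"
  by (simp add: supp_def)

lemma supp_zero [simp]: "supp 0 = {}"
  by (simp add: supp_def)

lemma supp_dirac [simp]: "supp (dirac y) = {y}"
  by (simp add: supp_def dirac_def)

lemma supp_add_subset: "supp (\<xi> + \<zeta>) \<subseteq> supp \<xi> \<union> supp \<zeta>"
  by (auto simp: supp_def)

lemma supp_scaleR: "supp (r *\<^sub>R \<xi>) = (if r = 0 then {} else supp \<xi>)"
  by (simp add: supp_def)

lemma finite_supp_scaleR [simp]: "finite (supp \<xi>) \<Longrightarrow> finite (supp (r *\<^sub>R \<xi>))"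
  by (simp add: supp_scaleR)

lemma finite_supp_sum:
  "(\<And>i. i \<in> I \<Longrightarrow> finite (supp (\<xi> i))) \<Longrightarrow> finite (supp (\<Sum>i\<in>I. \<xi> i))"
  by (induction I rule: infinite_finite_induct) (auto intro: finite_subset[OF supp_add_subset])

lemma bind_superset: "finite S \<Longrightarrow> supp \<xi> \<subseteq> S \<Longrightarrow> bind \<xi> \<theta> = (\<Sum>y\<in>S. \<xi> y *\<^sub>R \<theta> y)"
  unfolding bind_def by (rule sum.mono_neutral_left) (auto simp: supp_def)

lemma bind_cong: "(\<And>y. y \<in> supp \<xi> \<Longrightarrow> \<theta> y = \<theta>' y) \<Longrightarrow> bind \<xi> \<theta> = bind \<xi> \<theta>'"
  by (simp add: bind_def)

lemma bind_apply: "bind \<xi> \<theta> z = bind \<xi> (\<lambda>y. \<theta> y z)"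
  by (simp add: bind_def sum_fun_apply)

lemma bind_zero [simp]: "bind 0 \<theta> = 0"
  by (simp add: bind_def)

lemma bind_dirac [simp]: "bind (dirac y) \<theta> = \<theta> y"
  unfolding bind_def supp_dirac by (simp add: dirac_def)

lemma bind_scaleR: "bind (r *\<^sub>R \<xi>) \<theta> = r *\<^sub>R bind \<xi> \<theta>"
  by (cases "r = 0") (simp_all add: bind_def supp_scaleR scaleR_sum_right)

lemma bind_add:
  assumes "finite (supp \<xi>)" "finite (supp \<zeta>)"
  shows "bind (\<xi> + \<zeta>) \<theta> = bind \<xi> \<theta> + bind \<zeta> \<theta>"
proof -
  have "bind \<alpha> \<theta> = (\<Sum>y\<in>supp \<xi> \<union> supp \<zeta>. \<alpha> y *\<^sub>R \<theta> y)" if "supp \<alpha> \<subseteq> supp \<xi> \<union> supp \<zeta>" for \<alpha>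
    using assms that by (intro bind_superset) auto
  then show ?thesis
    by (simp add: supp_add_subset scaleR_add_left sum.distrib)
qed

lemma bind_sum:
  assumes "\<And>i. i \<in> I \<Longrightarrow> finite (supp (\<xi> i))"
  shows "bind (\<Sum>i\<in>I. \<xi> i) \<theta> = (\<Sum>i\<in>I. bind (\<xi> i) \<theta>)"
  using assms by (induction I rule: infinite_finite_induct) (simp_all add: bind_add finite_supp_sum)

lemma bind_assoc:
  assumes "\<And>y. y \<in> supp \<xi> \<Longrightarrow> finite (supp (\<omega> y))"
  shows "bind (bind \<xi> \<omega>) \<theta> = bind \<xi> (\<lambda>y. bind (\<omega> y) \<theta>)"
proof -
  have "bind (bind \<xi> \<omega>) \<theta> = (\<Sum>y\<in>supp \<xi>. bind (\<xi> y *\<^sub>R \<omega> y) \<theta>)"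
    unfolding bind_def[of \<xi> \<omega>] using assms by (intro bind_sum) simp
  then show ?thesis
    by (simp add: bind_scaleR bind_def[of \<xi>])
qed

lemma bind_eq_Sum_any:
  assumes "finite (supp \<xi>)"
  shows "bind \<xi> \<theta> = Sum_any (\<lambda>y. \<xi> y * \<theta> y)"
  unfolding bind_superset[OF assms subset_refl] using assms
  by (subst Sum_any.expand_superset[of "supp \<xi>"]) (auto simp: supp_def)

lemma Sum_any_eq_bind: "Sum_any \<xi> = bind \<xi> (\<lambda>_. 1)"
  by (simp add: bind_def supp_def Sum_any.expand_set)

lemma Sum_any_bind:
  assumes "\<And>y. y \<in> supp \<xi> \<Longrightarrow> finite (supp (\<theta> y))"
  shows "Sum_any (bind \<xi> \<theta>) = bind \<xi> (\<lambda>y. Sum_any (\<theta> y))"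
  unfolding Sum_any_eq_bind using assms by (rule bind_assoc)

lemma Sum_any_scaleR_add_scaleR:
  "finite (supp \<xi>) \<Longrightarrow> finite (supp \<zeta>) \<Longrightarrow>
    Sum_any (s *\<^sub>R \<xi> + t *\<^sub>R \<zeta>) = s * Sum_any \<xi> + t * Sum_any \<zeta>"
  unfolding Sum_any_eq_bind by (simp add: bind_add bind_scaleR)

lemma bind_pushforward: "bind (pushforward h \<xi>) \<theta> = bind \<xi> (\<lambda>x. \<theta> (h x))"
  unfolding pushforward_def by (subst bind_assoc) simp_all

lemma pushforward_bind:
  assumes "\<And>y. y \<in> supp \<xi> \<Longrightarrow> finite (supp (\<omega> y))"
  shows "pushforward h (bind \<xi> \<omega>) = bind \<xi> (\<lambda>y. pushforward h (\<omega> y))"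
  unfolding pushforward_def using assms by (rule bind_assoc)

lemma Sum_any_pushforward: "Sum_any (pushforward h \<xi>) = Sum_any \<xi>"
  unfolding Sum_any_eq_bind bind_pushforward ..

section \<open>Valuations and distributions\<close>

lemma valuations_iff: "\<xi> \<in> valuations Y \<longleftrightarrow> finite (supp \<xi>) \<and> supp \<xi> \<subseteq> Y \<and> (\<forall>y. 0 \<le> \<xi> y)"
  by (simp add: valuations_def supp_def)

lemma valuation_nonneg: "\<xi> \<in> valuations Y \<Longrightarrow> 0 \<le> \<xi> y"
  by (simp add: valuations_iff)

lemma zero_in_valuations [simp]: "0 \<in> valuations Y"
  by (simp add: valuations_iff)

lemma dirac_in_valuations: "y \<in> Y \<Longrightarrow> dirac y \<in> valuations Y"
  unfolding valuations_iff supp_dirac by (simp add: dirac_def)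

lemma add_in_valuations: "\<xi> \<in> valuations Y \<Longrightarrow> \<zeta> \<in> valuations Y \<Longrightarrow> \<xi> + \<zeta> \<in> valuations Y"
  using supp_add_subset[of \<xi> \<zeta>] by (auto simp: valuations_iff intro: finite_subset)

lemma scaleR_in_valuations: "0 \<le> r \<Longrightarrow> \<xi> \<in> valuations Y \<Longrightarrow> r *\<^sub>R \<xi> \<in> valuations Y"
  by (auto simp: valuations_iff supp_scaleR)

lemma sum_in_valuations: "(\<And>i. i \<in> I \<Longrightarrow> \<xi> i \<in> valuations Y) \<Longrightarrow> (\<Sum>i\<in>I. \<xi> i) \<in> valuations Y"
  by (induction I rule: infinite_finite_induct) (simp_all add: add_in_valuations)

lemma bind_in_valuations:
  assumes "\<xi> \<in> valuations X" "\<And>y. y \<in> supp \<xi> \<Longrightarrow> \<theta> y \<in> valuations Y"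
  shows "bind \<xi> \<theta> \<in> valuations Y"
  unfolding bind_def using assms
  by (intro sum_in_valuations scaleR_in_valuations) (auto intro: valuation_nonneg)

lemma finite_supp_valuation [simp]: "\<xi> \<in> valuations Y \<Longrightarrow> finite (supp \<xi>)"
  by (simp add: valuations_iff)

lemma convex_valuations: "convex (valuations Y)"
  by (simp add: convex_def add_in_valuations scaleR_in_valuations)

lemma convex_hull_subset_valuations: "G \<subseteq> valuations Y \<Longrightarrow> convex hull G \<subseteq> valuations Y"
  by (intro hull_minimal convex_valuations)

lemma distsD:
  assumes "\<xi> \<in> dists"
  shows "\<xi> \<in> valuations UNIV" "Sum_any \<xi> = 1"
  using assms by (auto simp: dists_def)

lemma dirac_in_dists: "dirac x \<in> dists"
  by (simp add: dists_def dirac_in_valuations Sum_any_eq_bind)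

lemma convex_dists: "convex dists"
proof (rule convexI)
  fix \<xi> \<zeta> :: "'x \<Rightarrow> real" and s t :: real
  assume \<xi>: "\<xi> \<in> dists" and \<zeta>: "\<zeta> \<in> dists" and weights: "0 \<le> s" "0 \<le> t" "s + t = 1"
  have "Sum_any (s *\<^sub>R \<xi> + t *\<^sub>R \<zeta>) = s * Sum_any \<xi> + t * Sum_any \<zeta>"
    by (intro Sum_any_scaleR_add_scaleR finite_supp_valuation[OF distsD(1)] \<xi> \<zeta>)
  also have "\<dots> = 1"
    using distsD(2)[OF \<xi>] distsD(2)[OF \<zeta>] weights(3) by simp
  finally show "s *\<^sub>R \<xi> + t *\<^sub>R \<zeta> \<in> dists"
    using distsD(1)[OF \<xi>] distsD(1)[OF \<zeta>] weights(1,2) unfolding dists_def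
    by (intro CollectI conjI add_in_valuations scaleR_in_valuations)
qed

lemma diff_bind_dist:
  fixes c :: real
  assumes "\<xi> \<in> dists"
  shows "c - bind \<xi> s = (\<Sum>y\<in>supp \<xi>. \<xi> y * (c - s y))"
proof -
  have "(\<Sum>y\<in>supp \<xi>. \<xi> y) = 1"
    using distsD(2)[OF assms] by (simp add: Sum_any_eq_bind bind_def)
  then show ?thesis
    by (simp add: bind_def right_diff_distrib sum_subtractf sum_distrib_right[symmetric])
qed

lemma bind_dist_le:
  fixes c :: real
  assumes "\<xi> \<in> dists" "\<And>y. y \<in> supp \<xi> \<Longrightarrow> s y \<le> c"
  shows "bind \<xi> s \<le> c"
proof -
  have "0 \<le> c - bind \<xi> s"
    unfolding diff_bind_dist[OF assms(1)] using assms(2) valuation_nonneg[OF distsD(1)[OF assms(1)]]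
    by (intro sum_nonneg mult_nonneg_nonneg) auto
  then show ?thesis by simp
qed

lemma bind_dist_eq_upper_boundD:
  fixes c :: real
  assumes "\<xi> \<in> dists" "\<And>y. y \<in> supp \<xi> \<Longrightarrow> s y \<le> c" "bind \<xi> s = c" "y \<in> supp \<xi>"
  shows "s y = c"
proof -
  have "(\<Sum>y\<in>supp \<xi>. \<xi> y * (c - s y)) = 0"
    using diff_bind_dist[OF assms(1), of c s] assms(3) by simp
  then have "\<xi> y * (c - s y) = 0"
    using assms(2,4) distsD(1)[OF assms(1)] valuation_nonneg[OF distsD(1)[OF assms(1)]]
    by (subst (asm) sum_nonneg_eq_0_iff) auto
  then show ?thesis
    using assms(4) by (simp add: in_supp_iff)
qed

lemma C0M_iff: "M \<in> C0M Y \<longleftrightarrow> 0 \<in> M \<and> M \<subseteq> valuations Y \<and> convex M"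
proof
  assume M: "M \<in> C0M Y"
  then have sum_closed: "(\<Sum>i<n. r i *\<^sub>R \<xi> i) \<in> M"
    if "\<forall>i<n. \<xi> i \<in> M \<and> 0 \<le> r i" "(\<Sum>i<n. r i) \<le> 1" for n :: nat and r \<xi>
    using that unfolding C0M_def sum_scaleR_fun_eq by blast
  have "convex M"
  proof (rule convexI)
    fix \<xi> \<zeta> and s t :: real assume "\<xi> \<in> M" "\<zeta> \<in> M" "0 \<le> s" "0 \<le> t" "s + t = 1"
    then show "s *\<^sub>R \<xi> + t *\<^sub>R \<zeta> \<in> M"
      using sum_closed[of 2 "\<lambda>i. if i = 0 then \<xi> else \<zeta>" "\<lambda>i. if i = 0 then s else t"]
      by (simp add: numeral_2_eq_2)
  qed
  then show "0 \<in> M \<and> M \<subseteq> valuations Y \<and> convex M"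
    using M sum_closed[of 0] by (simp add: C0M_def)
next
  assume M: "0 \<in> M \<and> M \<subseteq> valuations Y \<and> convex M"
  then have "(\<Sum>i<n. r i *\<^sub>R \<xi> i) \<in> M" if "\<forall>i<n. \<xi> i \<in> M \<and> 0 \<le> r i" "(\<Sum>i<n. r i) \<le> 1"
    for n :: nat and r \<xi>
    using that by (auto intro: convex_sum_le_one)
  then show "M \<in> C0M Y"
    using M by (auto simp: C0M_def sum_scaleR_fun_eq)
qed

section \<open>Binding a selection from a family of sets\<close>

text \<open>Only the sets over the support matter: a branch of probability zero needs no continuation.\<close>

definition bind_set :: "('y \<Rightarrow> real) \<Rightarrow> ('y \<Rightarrow> 'v set) \<Rightarrow> 'v::real_vector set" where
  "bind_set \<xi> M = {bind \<xi> \<theta> | \<theta>. \<forall>y\<in>supp \<xi>. \<theta> y \<in> M y}"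

lemma bind_setI: "(\<And>y. y \<in> supp \<xi> \<Longrightarrow> \<theta> y \<in> M y) \<Longrightarrow> bind \<xi> \<theta> \<in> bind_set \<xi> M"
  unfolding bind_set_def by blast

lemma bind_setE:
  assumes "v \<in> bind_set \<xi> M"
  obtains \<theta> where "v = bind \<xi> \<theta>" "\<And>y. y \<in> supp \<xi> \<Longrightarrow> \<theta> y \<in> M y"
  using assms unfolding bind_set_def by blast

lemma bind_set_totalE:
  assumes "v \<in> bind_set \<xi> M" "\<And>y. M y \<noteq> {}"
  obtains \<theta> where "v = bind \<xi> \<theta>" "\<And>y. \<theta> y \<in> M y"
proof -
  obtain \<theta> where \<theta>: "v = bind \<xi> \<theta>" "\<And>y. y \<in> supp \<xi> \<Longrightarrow> \<theta> y \<in> M y"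
    using assms(1) by (elim bind_setE) auto
  show ?thesis
  proof (rule that)
    let ?\<theta> = "\<lambda>y. if y \<in> supp \<xi> then \<theta> y else SOME w. w \<in> M y"
    show "v = bind \<xi> ?\<theta>"
      unfolding \<theta>(1) by (rule bind_cong) simp
    show "?\<theta> y \<in> M y" for y
      using \<theta>(2) assms(2) by (simp add: some_in_eq)
  qed
qed

lemma scaleR_in_bind_set: "v \<in> bind_set \<xi> M \<Longrightarrow> r *\<^sub>R v \<in> bind_set (r *\<^sub>R \<xi>) M"
  by (auto simp: bind_scaleR[symmetric] supp_scaleR elim!: bind_setE intro!: bind_setI
      split: if_splits)

lemma add_in_bind_set:
  assumes "\<xi> \<in> valuations X" "\<zeta> \<in> valuations Y" "\<And>y. convex (M y)"
    and "v \<in> bind_set \<xi> M" "w \<in> bind_set \<zeta> M"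
  shows "v + w \<in> bind_set (\<xi> + \<zeta>) M"
proof -
  obtain \<theta> \<phi> where v: "v = bind \<xi> \<theta>" "\<And>y. y \<in> supp \<xi> \<Longrightarrow> \<theta> y \<in> M y"
    and w: "w = bind \<zeta> \<phi>" "\<And>y. y \<in> supp \<zeta> \<Longrightarrow> \<phi> y \<in> M y"
    using assms(4,5) by (elim bind_setE) auto
  have "\<exists>z. \<xi> y *\<^sub>R \<theta> y + \<zeta> y *\<^sub>R \<phi> y = (\<xi> y + \<zeta> y) *\<^sub>R z \<and> (\<xi> y + \<zeta> y \<noteq> 0 \<longrightarrow> z \<in> M y)" for y
    using convex_weighted_mean[OF assms(3)[of y], of "\<xi> y" "\<zeta> y" "\<theta> y" "\<phi> y"]
      valuation_nonneg[OF assms(1)] valuation_nonneg[OF assms(2)] v(2) w(2)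
    by (metis in_supp_iff)
  then obtain \<psi> where \<psi>: "\<And>y. \<xi> y *\<^sub>R \<theta> y + \<zeta> y *\<^sub>R \<phi> y = (\<xi> y + \<zeta> y) *\<^sub>R \<psi> y"
    "\<And>y. \<xi> y + \<zeta> y \<noteq> 0 \<Longrightarrow> \<psi> y \<in> M y"
    by metis
  let ?S = "supp \<xi> \<union> supp \<zeta>"
  have S: "finite ?S" "supp (\<xi> + \<zeta>) \<subseteq> ?S"
    using assms(1,2) supp_add_subset[of \<xi> \<zeta>] by auto
  have "v + w = (\<Sum>y\<in>?S. \<xi> y *\<^sub>R \<theta> y + \<zeta> y *\<^sub>R \<phi> y)"
    using S(1) by (simp add: v(1) w(1) bind_superset[of ?S] sum.distrib)
  also have "\<dots> = bind (\<xi> + \<zeta>) \<psi>"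
    using S by (simp add: \<psi>(1) bind_superset[of ?S])
  finally show ?thesis
    using \<psi>(2) by (auto simp: in_supp_iff intro: bind_setI)
qed

lemma sum_in_bind_set:
  assumes "finite I" "\<And>y. convex (M y)"
    and "\<And>i. i \<in> I \<Longrightarrow> \<xi> i \<in> valuations X" "\<And>i. i \<in> I \<Longrightarrow> v i \<in> bind_set (\<xi> i) M"
  shows "sum v I \<in> bind_set (sum \<xi> I) M"
  using assms(1,3,4)
proof (induction I rule: finite_induct)
  case empty
  show "sum v {} \<in> bind_set (sum \<xi> {}) M"
    using bind_setI[of 0 "\<lambda>_. 0" M] by simp
next
  case (insert i I)
  have "v i + sum v I \<in> bind_set (\<xi> i + sum \<xi> I) M"
    using insert.prems insert.IH
    by (intro add_in_bind_set[where X = X and Y = X] sum_in_valuations assms(2)) auto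
  then show "sum v (insert i I) \<in> bind_set (sum \<xi> (insert i I)) M"
    using insert.hyps by simp
qed

lemma convex_UN_bind_set:
  assumes "convex S" "S \<subseteq> valuations Y" "\<And>y. convex (M y)"
  shows "convex (\<Union>\<xi>\<in>S. bind_set \<xi> M)"
proof (rule convexI)
  fix v w and s t :: real
  assume "v \<in> (\<Union>\<xi>\<in>S. bind_set \<xi> M)" "w \<in> (\<Union>\<xi>\<in>S. bind_set \<xi> M)"
    and weights: "0 \<le> s" "0 \<le> t" "s + t = 1"
  then obtain \<xi> \<zeta> where mem: "\<xi> \<in> S" "\<zeta> \<in> S" "v \<in> bind_set \<xi> M" "w \<in> bind_set \<zeta> M"
    by blast
  then have "s *\<^sub>R v + t *\<^sub>R w \<in> bind_set (s *\<^sub>R \<xi> + t *\<^sub>R \<zeta>) M"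
    using assms weights by (intro add_in_bind_set scaleR_in_bind_set scaleR_in_valuations) auto
  then show "s *\<^sub>R v + t *\<^sub>R w \<in> (\<Union>\<xi>\<in>S. bind_set \<xi> M)"
    using convexD[OF assms(1) mem(1,2) weights] by blast
qed

lemma convex_pushforward_image:
  assumes "convex S" "S \<subseteq> valuations X"
  shows "convex (pushforward h ` S)"
proof -
  have "pushforward h ` S = (\<Union>\<xi>\<in>S. bind_set \<xi> (\<lambda>x. {dirac (h x)}))"
    by (auto simp: bind_set_def pushforward_def intro: bind_cong)
  then show ?thesis
    using assms by (auto intro!: convex_UN_bind_set)
qed

text \<open>The selection over \<open>h x\<close> is the conditional expectation of \<open>\<theta>\<close> given \<open>h\<close>.\<close>

lemma bind_in_bind_set_pushforward:
  assumes "\<xi> \<in> valuations X" "\<And>z. convex (M z)" "\<And>x. x \<in> supp \<xi> \<Longrightarrow> \<theta> x \<in> M (h x)"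
  shows "bind \<xi> \<theta> \<in> bind_set (pushforward h \<xi>) M"
proof -
  have "\<theta> x \<in> bind_set (dirac (h x)) M" if "x \<in> supp \<xi>" for x
    using bind_setI[of "dirac (h x)" "\<lambda>_. \<theta> x" M] that assms(3) by simp
  then show ?thesis
    unfolding bind_def[of \<xi>] pushforward_def using assms(1,2)
    by (intro sum_in_bind_set[where X = UNIV] scaleR_in_bind_set scaleR_in_valuations
        dirac_in_valuations)
      (auto intro: valuation_nonneg)
qed

lemma bind_convex_hull:
  assumes "\<xi> \<in> convex hull G" "G \<subseteq> valuations X" "convex M" "\<And>\<zeta>. \<zeta> \<in> G \<Longrightarrow> bind \<zeta> \<theta> \<in> M"
  shows "bind \<xi> \<theta> \<in> M"
proof -
  have "convex {\<xi> \<in> valuations X. bind \<xi> \<theta> \<in> M}"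
    by (intro convexI)
      (auto simp: bind_add bind_scaleR intro: convexD[OF convex_valuations] convexD[OF assms(3)])
  then have "convex hull G \<subseteq> {\<xi> \<in> valuations X. bind \<xi> \<theta> \<in> M}"
    using assms(2,4) by (intro hull_minimal) auto
  then show ?thesis
    using assms(1) by blast
qed

lemma convex_hull_UN:
  "convex hull (\<Union>i. S i) = (\<Union>\<xi>\<in>dists. bind_set \<xi> (\<lambda>i. convex hull S i))" (is "_ = ?mixtures")
proof
  have "v \<in> bind_set (dirac i) (\<lambda>i. convex hull S i)" if "v \<in> S i" for i v
    using bind_setI[of "dirac i" "\<lambda>_. v" "\<lambda>i. convex hull S i"] that by (simp add: hull_inc)
  then have "(\<Union>i. S i) \<subseteq> ?mixtures"
    using dirac_in_dists by fast
  moreover have "convex ?mixtures"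
    by (rule convex_UN_bind_set[OF convex_dists _ convex_convex_hull]) (auto dest: distsD(1))
  ultimately show "convex hull (\<Union>i. S i) \<subseteq> ?mixtures"
    by (rule hull_minimal)
  have "bind \<xi> \<theta> \<in> convex hull (\<Union>i. S i)"
    if \<xi>: "\<xi> \<in> dists" and \<theta>: "\<And>i. i \<in> supp \<xi> \<Longrightarrow> \<theta> i \<in> convex hull S i" for \<xi> \<theta>
    unfolding bind_def
  proof (rule convex_sum[OF _ convex_convex_hull])
    show "finite (supp \<xi>)" "sum \<xi> (supp \<xi>) = 1" "0 \<le> \<xi> i" for i
      using distsD[OF \<xi>] valuation_nonneg by (auto simp: Sum_any_eq_bind bind_def)
    show "\<theta> i \<in> convex hull (\<Union>i. S i)" if "i \<in> supp \<xi>" for i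
      using \<theta>[OF that] hull_mono[of "S i" "\<Union>i. S i" convex] by blast
  qed
  then show "?mixtures \<subseteq> convex hull (\<Union>i. S i)"
    by (auto elim!: bind_setE)
qed

lemma bind_bool: "bind \<xi> \<theta> = \<xi> True *\<^sub>R \<theta> True + \<xi> False *\<^sub>R \<theta> False"
  by (subst bind_superset[OF finite subset_UNIV]) (simp add: UNIV_bool add.commute)

lemma dists_bool_iff: "\<xi> \<in> dists \<longleftrightarrow> 0 \<le> \<xi> True \<and> \<xi> True \<le> 1 \<and> \<xi> False = 1 - \<xi> True"
  by (auto simp: dists_def valuations_iff Sum_any_eq_bind bind_bool all_bool_eq)

lemma convex_hull_Un:
  fixes S T :: "'v::real_vector set"
  shows "convex hull (S \<union> T) = {p *\<^sub>R x + (1 - p) *\<^sub>R y | p x y. 0 \<le> p \<and> p \<le> 1 \<and>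
    (p \<noteq> 0 \<longrightarrow> x \<in> convex hull S) \<and> (1 - p \<noteq> 0 \<longrightarrow> y \<in> convex hull T)}" (is "_ = ?mixtures")
proof -
  let ?F = "\<lambda>b. convex hull (if b then S else T)"
  have "S \<union> T = (\<Union>b. if b then S else T)"
    by (auto split: if_splits)
  then have hull: "convex hull (S \<union> T) = (\<Union>\<xi>\<in>dists. bind_set \<xi> ?F)"
    by (simp only: convex_hull_UN)
  have "(\<Union>\<xi>\<in>dists. bind_set \<xi> ?F) \<subseteq> ?mixtures"
  proof (intro UN_least subsetI)
    fix \<xi> v assume \<xi>: "\<xi> \<in> dists" and "v \<in> bind_set \<xi> ?F"
    then obtain \<theta> where v: "v = bind \<xi> \<theta>" and \<theta>: "\<And>b. b \<in> supp \<xi> \<Longrightarrow> \<theta> b \<in> ?F b"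
      by (elim bind_setE) auto
    show "v \<in> ?mixtures"
      using \<xi> \<theta>[of True] \<theta>[of False] unfolding v bind_bool dists_bool_iff in_supp_iff by auto
  qed
  moreover have "p *\<^sub>R x + (1 - p) *\<^sub>R y \<in> (\<Union>\<xi>\<in>dists. bind_set \<xi> ?F)"
    if "0 \<le> p" "p \<le> 1" "p \<noteq> 0 \<longrightarrow> x \<in> convex hull S" "1 - p \<noteq> 0 \<longrightarrow> y \<in> convex hull T" for p x y
  proof
    let ?\<xi> = "\<lambda>b. if b then p else 1 - p"
    show "?\<xi> \<in> dists"
      using that by (simp add: dists_bool_iff)
    have "bind ?\<xi> (\<lambda>b. if b then x else y) \<in> bind_set ?\<xi> ?F"
      using that by (intro bind_setI) (auto simp: in_supp_iff split: if_splits)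
    then show "p *\<^sub>R x + (1 - p) *\<^sub>R y \<in> bind_set ?\<xi> ?F"
      by (simp add: bind_bool)
  qed
  then have "?mixtures \<subseteq> (\<Union>\<xi>\<in>dists. bind_set \<xi> ?F)"
    by blast
  ultimately show ?thesis
    unfolding hull by (rule subset_antisym)
qed

section \<open>Labelled valuations\<close>

definition label :: "('x \<Rightarrow> real) \<Rightarrow> 'a \<Rightarrow> 'x \<times> 'a \<Rightarrow> real" where
  "label \<xi> a = (\<lambda>(x, c). if c = a then \<xi> x else 0)"

lemma supp_label: "supp (label \<xi> a) = (\<lambda>x. (x, a)) ` supp \<xi>"
  by (auto simp: supp_def label_def split: if_splits)

lemma linear_label: "linear (\<lambda>\<xi>. label \<xi> a)"
  by (rule linearI) (auto simp: label_def)

lemma label_in_valuations: "\<xi> \<in> valuations UNIV \<Longrightarrow> label \<xi> a \<in> valuations UNIV"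
  unfolding valuations_iff supp_label by (auto simp: label_def)

lemma bind_label: "bind (label \<xi> a) \<theta> = bind \<xi> (\<lambda>x. \<theta> (x, a))"
  unfolding bind_def supp_label
  by (subst sum.reindex) (auto simp: inj_on_def label_def)

section \<open>Weak transitions\<close>

definition steps :: "('x, 'a) segala \<Rightarrow> 'x \<Rightarrow> 'a \<Rightarrow> ('x \<Rightarrow> real) set" where
  "steps f x a = {\<xi>. (\<xi>, a) \<in> f x}"

text \<open>
  After a step \<open>c\<close> of a weak transition along \<open>a\<close>, a weak transition along \<open>d\<close> remains to be made.
  Recording \<open>d\<close> next to the state reached turns the two summands in the recursion for
  \<^const>\<open>weak_trans\<close> into one valuation on pairs. For \<open>a = \<tau>\<close> the two labels agree, which is why
  the two kernels have to agree then.
\<close>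

definition residuals :: "'a \<Rightarrow> 'a \<Rightarrow> ('a \<times> 'a) set" where
  "residuals \<tau> a = {(a, \<tau>), (\<tau>, a)}"

definition residual_steps :: "'a \<Rightarrow> ('x, 'a) segala \<Rightarrow> 'x \<Rightarrow> 'a \<Rightarrow> ('x \<times> 'a \<Rightarrow> real) set" where
  "residual_steps \<tau> f x a = {label \<xi> d | \<xi> c d. (\<xi>, c) \<in> f x \<and> (c, d) \<in> residuals \<tau> a}"

abbreviation weak_trans_set ::
    "'a \<Rightarrow> ('x, 'a) segala \<Rightarrow> nat \<Rightarrow> 'x \<times> 'a \<Rightarrow> ('x \<Rightarrow> real) set" where
  "weak_trans_set \<tau> f n \<equiv> \<lambda>(y, d). {\<xi>. weak_trans \<tau> f n y d \<xi>}"

lemma segala_system_dists: "segala_system f \<Longrightarrow> (\<xi>, a) \<in> f x \<Longrightarrow> \<xi> \<in> dists"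
  by (auto simp: segala_system_def)

lemma segala_system_valuations: "segala_system f \<Longrightarrow> (\<xi>, a) \<in> f x \<Longrightarrow> \<xi> \<in> valuations UNIV"
  by (blast intro: segala_system_dists distsD(1))

lemma segala_system_idle: "segala_system f \<Longrightarrow> segala_system (idle \<tau> f)"
  by (auto simp: segala_system_def idle_def dirac_in_dists)

lemma combined_step_iff: "combined_step f x a \<xi> \<longleftrightarrow> \<xi> \<in> convex hull steps f x a"
  unfolding combined_step_def convex_hull_indexed_lessThan sum_scaleR_fun_eq steps_def by simp

lemma scaleR_combined_step_in_valuations:
  assumes "segala_system f" "0 \<le> p" "p \<noteq> 0 \<Longrightarrow> combined_step f x a \<zeta>"
  shows "p *\<^sub>R \<zeta> \<in> valuations UNIV"
proof (cases "p = 0")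
  case False
  have "convex hull steps f x a \<subseteq> valuations UNIV"
    using segala_system_valuations[OF assms(1)]
    by (intro convex_hull_subset_valuations) (auto simp: steps_def)
  then show ?thesis
    using False assms(2,3) by (auto simp: combined_step_iff intro: scaleR_in_valuations)
qed simp

lemma convex_hull_residual_steps:
  "convex hull residual_steps \<tau> f x a = {p *\<^sub>R label \<zeta>a \<tau> + (1 - p) *\<^sub>R label \<zeta>\<tau> a | p \<zeta>a \<zeta>\<tau>.
    0 \<le> p \<and> p \<le> 1 \<and> (p \<noteq> 0 \<longrightarrow> combined_step f x a \<zeta>a) \<and> (1 - p \<noteq> 0 \<longrightarrow> combined_step f x \<tau> \<zeta>\<tau>)}"
  (is "_ = ?mixtures")
proof -
  have "residual_steps \<tau> f x a = (\<lambda>\<xi>. label \<xi> \<tau>) ` steps f x a \<union> (\<lambda>\<xi>. label \<xi> a) ` steps f x \<tau>"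
    by (auto simp: residual_steps_def steps_def residuals_def)
  then have hull: "convex hull residual_steps \<tau> f x a = {p *\<^sub>R \<alpha> + (1 - p) *\<^sub>R \<beta> | p \<alpha> \<beta>.
      0 \<le> p \<and> p \<le> 1 \<and>
      (p \<noteq> 0 \<longrightarrow> \<alpha> \<in> (\<lambda>\<xi>. label \<xi> \<tau>) ` (convex hull steps f x a)) \<and>
      (1 - p \<noteq> 0 \<longrightarrow> \<beta> \<in> (\<lambda>\<xi>. label \<xi> a) ` (convex hull steps f x \<tau>))}" (is "_ = ?labelled")
    by (simp only: convex_hull_Un convex_hull_linear_image[OF linear_label])
  have "?labelled \<subseteq> ?mixtures"
  proof
    fix \<zeta> assume "\<zeta> \<in> ?labelled"
    then obtain p \<alpha> \<beta> where p: "0 \<le> p" "p \<le> 1" and \<zeta>: "\<zeta> = p *\<^sub>R \<alpha> + (1 - p) *\<^sub>R \<beta>"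
      and "p \<noteq> 0 \<longrightarrow> \<alpha> \<in> (\<lambda>\<xi>. label \<xi> \<tau>) ` (convex hull steps f x a)"
      and "1 - p \<noteq> 0 \<longrightarrow> \<beta> \<in> (\<lambda>\<xi>. label \<xi> a) ` (convex hull steps f x \<tau>)"
      by blast
    then have "\<exists>\<zeta>a. p \<noteq> 0 \<longrightarrow> combined_step f x a \<zeta>a \<and> \<alpha> = label \<zeta>a \<tau>"
      and "\<exists>\<zeta>\<tau>. 1 - p \<noteq> 0 \<longrightarrow> combined_step f x \<tau> \<zeta>\<tau> \<and> \<beta> = label \<zeta>\<tau> a"
      unfolding combined_step_iff by blast+
    then obtain \<zeta>a \<zeta>\<tau> where steps: "p \<noteq> 0 \<longrightarrow> combined_step f x a \<zeta>a \<and> \<alpha> = label \<zeta>a \<tau>"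
      "1 - p \<noteq> 0 \<longrightarrow> combined_step f x \<tau> \<zeta>\<tau> \<and> \<beta> = label \<zeta>\<tau> a"
      by blast
    then have "\<zeta> = p *\<^sub>R label \<zeta>a \<tau> + (1 - p) *\<^sub>R label \<zeta>\<tau> a"
      unfolding \<zeta> by (cases "p = 0"; cases "p = 1") simp_all
    then show "\<zeta> \<in> ?mixtures"
      using p steps by blast
  qed
  moreover have "?mixtures \<subseteq> ?labelled"
    unfolding combined_step_iff by blast
  ultimately show ?thesis
    unfolding hull by (rule subset_antisym)
qed

lemma residual_steps_subset_valuations:
  "segala_system f \<Longrightarrow> residual_steps \<tau> f x a \<subseteq> valuations UNIV"
  by (auto simp: residual_steps_def intro: label_in_valuations segala_system_valuations)

lemma bind_label_mixture_eq_Sum_any: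
  assumes segala: "segala_system f" and p: "0 \<le> p" "p \<le> 1"
    and step_a: "p \<noteq> 0 \<Longrightarrow> combined_step f x a \<zeta>a" and step_\<tau>: "1 - p \<noteq> 0 \<Longrightarrow> combined_step f x \<tau> \<zeta>\<tau>"
  shows "bind (p *\<^sub>R label \<zeta>a \<tau> + (1 - p) *\<^sub>R label \<zeta>\<tau> a) \<theta> =
    (\<lambda>z. Sum_any (\<lambda>y. p * \<zeta>a y * \<theta> (y, \<tau>) z + (1 - p) * \<zeta>\<tau> y * \<theta> (y, a) z))"
proof
  fix z
  let ?\<alpha> = "p *\<^sub>R \<zeta>a" and ?\<beta> = "(1 - p) *\<^sub>R \<zeta>\<tau>"
  have fin: "finite (supp ?\<alpha>)" "finite (supp ?\<beta>)"
    using scaleR_combined_step_in_valuations[OF segala] p step_a step_\<tau>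
    by (meson diff_ge_0_iff_ge finite_supp_valuation)+
  have "bind (p *\<^sub>R label \<zeta>a \<tau> + (1 - p) *\<^sub>R label \<zeta>\<tau> a) \<theta> = bind (label ?\<alpha> \<tau> + label ?\<beta> a) \<theta>"
    by (simp only: linear_scale[OF linear_label])
  also have "\<dots> = bind ?\<alpha> (\<lambda>y. \<theta> (y, \<tau>)) + bind ?\<beta> (\<lambda>y. \<theta> (y, a))"
    using fin by (simp add: bind_add supp_label bind_label)
  finally have "bind (p *\<^sub>R label \<zeta>a \<tau> + (1 - p) *\<^sub>R label \<zeta>\<tau> a) \<theta> z =
      bind ?\<alpha> (\<lambda>y. \<theta> (y, \<tau>) z) + bind ?\<beta> (\<lambda>y. \<theta> (y, a) z)"
    by (simp only: plus_fun_apply bind_apply[of _ _ z])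
  also have "\<dots> = Sum_any (\<lambda>y. ?\<alpha> y * \<theta> (y, \<tau>) z) + Sum_any (\<lambda>y. ?\<beta> y * \<theta> (y, a) z)"
    by (simp only: bind_eq_Sum_any fin)
  also have "\<dots> = Sum_any (\<lambda>y. ?\<alpha> y * \<theta> (y, \<tau>) z + ?\<beta> y * \<theta> (y, a) z)"
    by (intro Sum_any.distrib[symmetric] fin[THEN finite_subset[rotated]]) (auto simp: supp_def)
  finally show "bind (p *\<^sub>R label \<zeta>a \<tau> + (1 - p) *\<^sub>R label \<zeta>\<tau> a) \<theta> z =
      Sum_any (\<lambda>y. p * \<zeta>a y * \<theta> (y, \<tau>) z + (1 - p) * \<zeta>\<tau> y * \<theta> (y, a) z)"
    by simp
qed

lemma weak_trans_Suc_imp_bind_set: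
  assumes segala: "segala_system f" and "weak_trans \<tau> f (Suc n) x a \<xi>"
  shows "\<exists>\<zeta> \<in> convex hull residual_steps \<tau> f x a. \<xi> \<in> bind_set \<zeta> (weak_trans_set \<tau> f n)"
proof -
  obtain p \<zeta>a \<zeta>\<tau> \<theta>a \<theta>\<tau> where p: "0 \<le> p" "p \<le> 1"
    and step: "p \<noteq> 0 \<longrightarrow> combined_step f x a \<zeta>a" "1 - p \<noteq> 0 \<longrightarrow> combined_step f x \<tau> \<zeta>\<tau>"
    and \<theta>\<tau>: "\<And>y. p * \<zeta>a y \<noteq> 0 \<Longrightarrow> weak_trans \<tau> f n y \<tau> (\<theta>\<tau> y)"
    and \<theta>a: "\<And>y. (1 - p) * \<zeta>\<tau> y \<noteq> 0 \<Longrightarrow> weak_trans \<tau> f n y a (\<theta>a y)"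
    and agree: "a = \<tau> \<longrightarrow> \<theta>a = \<theta>\<tau>"
    and \<xi>: "\<xi> = (\<lambda>z. Sum_any (\<lambda>y. p * \<zeta>a y * \<theta>\<tau> y z + (1 - p) * \<zeta>\<tau> y * \<theta>a y z))"
    using assms(2) unfolding weak_trans.simps by blast
  let ?\<theta> = "\<lambda>(y, d). if d = \<tau> then \<theta>\<tau> y else \<theta>a y"
  let ?\<zeta> = "p *\<^sub>R label \<zeta>a \<tau> + (1 - p) *\<^sub>R label \<zeta>\<tau> a"
  have "?\<zeta> \<in> convex hull residual_steps \<tau> f x a"
    unfolding convex_hull_residual_steps using p step by blast
  moreover have "\<xi> = bind ?\<zeta> ?\<theta>"
    using p step agree unfolding \<xi> by (subst bind_label_mixture_eq_Sum_any[OF segala]) auto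
  moreover have "?\<theta> (y, d) \<in> weak_trans_set \<tau> f n (y, d)" if in_supp: "(y, d) \<in> supp ?\<zeta>" for y d
  proof -
    consider "d = \<tau>" "p * \<zeta>a y \<noteq> 0" | "d = a" "(1 - p) * \<zeta>\<tau> y \<noteq> 0"
      using in_supp by (cases "p * \<zeta>a y = 0") (auto simp: in_supp_iff label_def split: if_splits)
    then show ?thesis
      using \<theta>\<tau> \<theta>a agree by cases auto
  qed
  then have "bind ?\<zeta> ?\<theta> \<in> bind_set ?\<zeta> (weak_trans_set \<tau> f n)"
    by (intro bind_setI) auto
  ultimately show ?thesis
    by blast
qed

lemma weak_trans_Suc_if_bind_set:
  assumes segala: "segala_system f"
    and "\<zeta> \<in> convex hull residual_steps \<tau> f x a" "\<xi> \<in> bind_set \<zeta> (weak_trans_set \<tau> f n)"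
  shows "weak_trans \<tau> f (Suc n) x a \<xi>"
proof -
  obtain p \<zeta>a \<zeta>\<tau> where p: "0 \<le> p" "p \<le> 1"
    and step: "p \<noteq> 0 \<longrightarrow> combined_step f x a \<zeta>a" "1 - p \<noteq> 0 \<longrightarrow> combined_step f x \<tau> \<zeta>\<tau>"
    and \<zeta>: "\<zeta> = p *\<^sub>R label \<zeta>a \<tau> + (1 - p) *\<^sub>R label \<zeta>\<tau> a"
    using assms(2) unfolding convex_hull_residual_steps by blast
  obtain \<theta> where \<xi>: "\<xi> = bind \<zeta> \<theta>" and \<theta>: "\<And>z. z \<in> supp \<zeta> \<Longrightarrow> \<theta> z \<in> weak_trans_set \<tau> f n z"
    using assms(3) by (elim bind_setE) auto
  have nonneg: "0 \<le> p * \<zeta>a y" "0 \<le> (1 - p) * \<zeta>\<tau> y" for y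
    using valuation_nonneg[OF scaleR_combined_step_in_valuations[OF segala], of p x a \<zeta>a y]
      valuation_nonneg[OF scaleR_combined_step_in_valuations[OF segala], of "1 - p" x \<tau> \<zeta>\<tau> y] p step
    by simp_all
  have weak_\<tau>: "weak_trans \<tau> f n y \<tau> (\<theta> (y, \<tau>))" if "p * \<zeta>a y \<noteq> 0" for y
    using \<theta>[of "(y, \<tau>)"] that nonneg[of y]
    by (simp add: \<zeta> in_supp_iff label_def add_nonneg_eq_0_iff)
  have weak_a: "weak_trans \<tau> f n y a (\<theta> (y, a))" if "(1 - p) * \<zeta>\<tau> y \<noteq> 0" for y
    using \<theta>[of "(y, a)"] that nonneg[of y]
    by (simp add: \<zeta> in_supp_iff label_def add_nonneg_eq_0_iff)
  have \<xi>_eq: "\<xi> = (\<lambda>z. Sum_any (\<lambda>y. p * \<zeta>a y * \<theta> (y, \<tau>) z + (1 - p) * \<zeta>\<tau> y * \<theta> (y, a) z))"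
    unfolding \<xi> \<zeta> using p step by (intro bind_label_mixture_eq_Sum_any[OF segala]) auto
  show ?thesis
    unfolding weak_trans.simps
    by (rule exI[of _ p], rule exI[of _ \<zeta>a], rule exI[of _ \<zeta>\<tau>],
        rule exI[of _ "\<lambda>y. \<theta> (y, a)"], rule exI[of _ "\<lambda>y. \<theta> (y, \<tau>)"])
      (use p step weak_\<tau> weak_a \<xi>_eq in simp)
qed

lemma weak_trans_Suc_iff:
  assumes "segala_system f"
  shows "weak_trans \<tau> f (Suc n) x a \<xi> \<longleftrightarrow>
    (\<exists>\<zeta> \<in> convex hull residual_steps \<tau> f x a. \<xi> \<in> bind_set \<zeta> (weak_trans_set \<tau> f n))"
  using weak_trans_Suc_imp_bind_set[OF assms] weak_trans_Suc_if_bind_set[OF assms] by blast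

declare weak_trans.simps(2) [simp del]

lemma weak_trans_in_valuations:
  assumes segala: "segala_system f"
  shows "weak_trans \<tau> f n x a \<xi> \<Longrightarrow> \<xi> \<in> valuations UNIV"
proof (induction n arbitrary: x a \<xi>)
  case 0
  then show ?case by (simp add: dirac_in_valuations)
next
  case (Suc n)
  then obtain \<zeta> \<theta> where \<zeta>: "\<zeta> \<in> convex hull residual_steps \<tau> f x a" and \<xi>: "\<xi> = bind \<zeta> \<theta>"
    and \<theta>: "\<And>z. z \<in> supp \<zeta> \<Longrightarrow> \<theta> z \<in> weak_trans_set \<tau> f n z"
    unfolding weak_trans_Suc_iff[OF segala] by (elim bexE bind_setE) auto
  have "\<theta> z \<in> valuations UNIV" if "z \<in> supp \<zeta>" for z
    using \<theta>[OF that] Suc.IH by (cases z) simp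
  then show ?case
    using \<zeta> convex_hull_subset_valuations[OF residual_steps_subset_valuations[OF segala]]
    unfolding \<xi>
    by (blast intro: bind_in_valuations)
qed

lemma convex_weak_trans:
  assumes segala: "segala_system f"
  shows "convex {\<xi>. weak_trans \<tau> f n x a \<xi>}"
proof (induction n arbitrary: x a)
  case 0
  then show ?case by (cases "a = \<tau>") simp_all
next
  case (Suc n)
  have set_eq: "{\<xi>. weak_trans \<tau> f (Suc n) x a \<xi>} =
      (\<Union>\<zeta>\<in>convex hull residual_steps \<tau> f x a. bind_set \<zeta> (weak_trans_set \<tau> f n))"
    unfolding weak_trans_Suc_iff[OF segala] by auto
  have "convex (weak_trans_set \<tau> f n z)" for z
    using Suc.IH by (cases z) simp
  then show ?case
    unfolding set_eq
    by (rule convex_UN_bind_set[OF convex_convex_hull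
          convex_hull_subset_valuations[OF residual_steps_subset_valuations[OF segala]]])
qed

lemma weak_trans_SucI:
  assumes "segala_system f" "(\<xi>, c) \<in> f x" "(c, d) \<in> residuals \<tau> a"
    and "\<And>y. y \<in> supp \<xi> \<Longrightarrow> weak_trans \<tau> f n y d (\<omega> y)"
  shows "weak_trans \<tau> f (Suc n) x a (bind \<xi> \<omega>)"
proof (rule weak_trans_Suc_if_bind_set[OF assms(1)])
  show "label \<xi> d \<in> convex hull residual_steps \<tau> f x a"
    using assms(2,3) by (auto simp: residual_steps_def intro!: hull_inc)
  have "bind (label \<xi> d) (\<lambda>(y, _). \<omega> y) \<in> bind_set (label \<xi> d) (weak_trans_set \<tau> f n)"
    using assms(4) by (intro bind_setI) (auto simp: supp_label)
  then show "bind \<xi> \<omega> \<in> bind_set (label \<xi> d) (weak_trans_set \<tau> f n)"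
    by (simp add: bind_label)
qed

definition weak_steps :: "'a \<Rightarrow> ('x, 'a) segala \<Rightarrow> 'x \<Rightarrow> 'a \<Rightarrow> ('x \<Rightarrow> real) set" where
  "weak_steps \<tau> f x a = (\<Union>n. {\<xi>. weak_trans \<tau> (idle \<tau> f) n x a \<xi>})"

lemma weak_steps_subset_valuations: "segala_system f \<Longrightarrow> weak_steps \<tau> f x a \<subseteq> valuations UNIV"
  by (auto simp: weak_steps_def intro: weak_trans_in_valuations[OF segala_system_idle])

lemma weak_trans_idle_mono:
  assumes "segala_system f" "weak_trans \<tau> (idle \<tau> f) m x a \<xi>" "m \<le> n"
  shows "weak_trans \<tau> (idle \<tau> f) n x a \<xi>"
  using assms(3,2)
proof (induction rule: dec_induct)
  case (step n)
  have "(dirac x, \<tau>) \<in> idle \<tau> f x" "(\<tau>, a) \<in> residuals \<tau> a"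
    by (simp_all add: idle_def residuals_def)
  then show ?case
    using weak_trans_SucI[OF segala_system_idle[OF assms(1)],
        where \<xi> = "dirac x" and c = \<tau> and d = a and \<omega> = "\<lambda>_. \<xi>"] step
    by simp
qed

lemma dirac_in_weak_steps: "dirac x \<in> weak_steps \<tau> f x \<tau>"
  unfolding weak_steps_def by (intro UN_I[of 0]) simp_all

lemma convex_weak_steps:
  assumes "segala_system f"
  shows "convex (weak_steps \<tau> f x a)"
proof (rule convexI)
  fix \<xi> \<zeta> and s t :: real
  assume "\<xi> \<in> weak_steps \<tau> f x a" "\<zeta> \<in> weak_steps \<tau> f x a" and weights: "0 \<le> s" "0 \<le> t" "s + t = 1"
  then obtain m n where "weak_trans \<tau> (idle \<tau> f) m x a \<xi>" "weak_trans \<tau> (idle \<tau> f) n x a \<zeta>"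
    unfolding weak_steps_def by blast
  then have "weak_trans \<tau> (idle \<tau> f) (max m n) x a \<xi>" "weak_trans \<tau> (idle \<tau> f) (max m n) x a \<zeta>"
    by (auto intro: weak_trans_idle_mono[OF assms])
  then have "s *\<^sub>R \<xi> + t *\<^sub>R \<zeta> \<in> {\<xi>. weak_trans \<tau> (idle \<tau> f) (max m n) x a \<xi>}"
    using weights by (intro convexD convex_weak_trans segala_system_idle assms) simp_all
  then show "s *\<^sub>R \<xi> + t *\<^sub>R \<zeta> \<in> weak_steps \<tau> f x a"
    unfolding weak_steps_def by blast
qed

lemma bind_in_weak_steps:
  assumes segala: "segala_system f" and \<xi>: "(\<xi>, c) \<in> f x" and residual: "(c, d) \<in> residuals \<tau> a"
    and \<omega>: "\<And>y. y \<in> supp \<xi> \<Longrightarrow> \<omega> y \<in> weak_steps \<tau> f y d"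
  shows "bind \<xi> \<omega> \<in> weak_steps \<tau> f x a"
proof -
  have "\<exists>n. weak_trans \<tau> (idle \<tau> f) n y d (\<omega> y)" if "y \<in> supp \<xi>" for y
    using \<omega>[OF that] by (simp add: weak_steps_def)
  then obtain n where n: "\<And>y. y \<in> supp \<xi> \<Longrightarrow> weak_trans \<tau> (idle \<tau> f) (n y) y d (\<omega> y)"
    by metis
  let ?N = "Max (n ` supp \<xi>)"
  have "n y \<le> ?N" if "y \<in> supp \<xi>" for y
    using that segala_system_valuations[OF segala \<xi>] by simp
  then have "weak_trans \<tau> (idle \<tau> f) ?N y d (\<omega> y)" if "y \<in> supp \<xi>" for y
    using weak_trans_idle_mono[OF segala n] that by blast
  moreover have "(\<xi>, c) \<in> idle \<tau> f x"
    using \<xi> by (simp add: idle_def)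
  ultimately have "weak_trans \<tau> (idle \<tau> f) (Suc ?N) x a (bind \<xi> \<omega>)"
    using residual by (intro weak_trans_SucI[OF segala_system_idle[OF segala]])
  then show ?thesis
    unfolding weak_steps_def by blast
qed

lemma bind_in_pushforward_weak_steps:
  assumes segala: "segala_system f" and \<xi>: "(\<xi>, c) \<in> f x" and residual: "(c, d) \<in> residuals \<tau> a"
    and \<theta>: "\<And>y. y \<in> supp \<xi> \<Longrightarrow> \<theta> y \<in> pushforward h ` weak_steps \<tau> f y d"
  shows "bind \<xi> \<theta> \<in> pushforward h ` weak_steps \<tau> f x a"
proof -
  have "\<exists>\<omega>. \<omega> \<in> weak_steps \<tau> f y d \<and> \<theta> y = pushforward h \<omega>" if "y \<in> supp \<xi>" for y
    using \<theta>[OF that] by blast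
  then obtain \<omega> where \<omega>: "\<And>y. y \<in> supp \<xi> \<Longrightarrow> \<omega> y \<in> weak_steps \<tau> f y d"
    and \<theta>_eq: "\<And>y. y \<in> supp \<xi> \<Longrightarrow> \<theta> y = pushforward h (\<omega> y)"
    by metis
  have "bind \<xi> \<theta> = bind \<xi> (\<lambda>y. pushforward h (\<omega> y))"
    using \<theta>_eq by (rule bind_cong)
  also have "\<dots> = pushforward h (bind \<xi> \<omega>)"
    using finite_supp_valuation[OF subsetD[OF weak_steps_subset_valuations[OF segala] \<omega>]]
    by (simp add: pushforward_bind)
  finally show ?thesis
    using bind_in_weak_steps[OF segala \<xi> residual \<omega>] by blast
qed

section \<open>The weak pattern\<close>

definition weak_lang :: "'a \<Rightarrow> 'a \<Rightarrow> 'a list set" where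
  "weak_lang \<tau> a = {w. filter (\<lambda>c. c \<noteq> \<tau>) w = (if a = \<tau> then [] else [a])}"

lemma weak_lang_silent: "weak_lang \<tau> \<tau> = lists {\<tau>}"
  by (auto simp: weak_lang_def filter_empty_conv)

lemma weak_lang_visible:
  assumes "a \<noteq> \<tau>"
  shows "weak_lang \<tau> a = {u @ [a] @ v | u v. u \<in> lists {\<tau>} \<and> v \<in> lists {\<tau>}}"
  using assms
  by (simp add: set_eq_iff weak_lang_def filter_eq_Cons_iff filter_empty_conv in_lists_conv_set
      eq_commute[of "[]"])

lemma weak_pattern_eq: "weak_pattern \<tau> = insert {} (range (weak_lang \<tau>))"
proof -
  have "{{u @ [a] @ v | u v. u \<in> lists {\<tau>} \<and> v \<in> lists {\<tau>}} | a. a \<noteq> \<tau>} =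
      {weak_lang \<tau> a | a. a \<noteq> \<tau>}"
    using weak_lang_visible[of _ \<tau>] by (intro Collect_cong ex_cong1) auto
  then show ?thesis
    unfolding weak_pattern_def by (auto simp: weak_lang_silent[symmetric])
qed

lemma Nil_in_weak_lang [simp]: "[] \<in> weak_lang \<tau> a \<longleftrightarrow> a = \<tau>"
  by (simp add: weak_lang_def)

lemma lang_quot_empty [simp]: "lang_quot {} a = {}"
  by (simp add: lang_quot_def)

lemma lang_quot_weak_lang:
  "lang_quot (weak_lang \<tau> a) c =
    (if c = \<tau> then weak_lang \<tau> a else if c = a then weak_lang \<tau> \<tau> else {})"
  by (auto simp: lang_quot_def weak_lang_def)

lemma lang_quot_weak_lang_nonemptyE:
  assumes "lang_quot (weak_lang \<tau> a) c \<noteq> {}"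
  obtains d where "(c, d) \<in> residuals \<tau> a" "lang_quot (weak_lang \<tau> a) c = weak_lang \<tau> d"
  using assms by (auto simp: lang_quot_weak_lang residuals_def split: if_splits)

lemma lang_quot_in_weak_pattern: "b \<in> weak_pattern \<tau> \<Longrightarrow> lang_quot b c \<in> weak_pattern \<tau>"
  by (auto simp: weak_pattern_eq lang_quot_weak_lang split: if_splits)

lemma lang_quot_silent: "b \<in> weak_pattern \<tau> \<Longrightarrow> lang_quot b \<tau> = b"
  by (auto simp: weak_pattern_eq lang_quot_weak_lang)

lemma lang_quot_residual:
  "b \<in> weak_pattern \<tau> \<Longrightarrow> (c, d) \<in> residuals \<tau> a \<Longrightarrow> lang_quot (lang_quot b c) d = lang_quot b a"
  by (auto simp: residuals_def lang_quot_silent lang_quot_in_weak_pattern)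

section \<open>Observations\<close>

inductive observable :: "('x, 'a) segala \<Rightarrow> ('x \<Rightarrow> 'y) \<Rightarrow> 'x \<Rightarrow> 'a list set \<Rightarrow> ('y \<Rightarrow> real) \<Rightarrow> bool"
  for f h where
  zero: "observable f h x b 0"
| halt: "[] \<in> b \<Longrightarrow> observable f h x b (dirac (h x))"
| step: "(\<xi>, a) \<in> f x \<Longrightarrow> (\<And>y. observable f h y (lang_quot b a) (\<theta> y)) \<Longrightarrow>
    observable f h x b (bind \<xi> \<theta>)"
| convex: "observable f h x b \<phi> \<Longrightarrow> observable f h x b \<psi> \<Longrightarrow> 0 \<le> s \<Longrightarrow> 0 \<le> t \<Longrightarrow> s + t = 1 \<Longrightarrow>
    observable f h x b (s *\<^sub>R \<phi> + t *\<^sub>R \<psi>)"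

abbreviation observations ::
    "('x, 'a) segala \<Rightarrow> ('x \<Rightarrow> 'y) \<Rightarrow> 'x \<Rightarrow> 'a list set \<Rightarrow> ('y \<Rightarrow> real) set" where
  "observations f h x b \<equiv> {\<phi>. observable f h x b \<phi>}"

lemma convex_observations: "convex (observations f h x b)"
  by (auto intro: convexI observable.convex)

lemma observable_in_valuations:
  assumes segala: "segala_system f" and h: "\<And>x. h x \<in> Y"
  shows "observable f h x b \<phi> \<Longrightarrow> \<phi> \<in> valuations Y"
proof (induction rule: observable.induct)
  case (step \<xi> a x b \<theta>)
  then show ?case
    by (blast intro: bind_in_valuations segala_system_valuations[OF segala])
qed (assumption | rule zero_in_valuations dirac_in_valuations h add_in_valuations
      scaleR_in_valuations)+

lemma finite_supp_observable: "segala_system f \<Longrightarrow> observable f h x b \<phi> \<Longrightarrow> finite (supp \<phi>)"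
  by (rule finite_supp_valuation[OF observable_in_valuations]) auto

lemma observations_in_C0M:
  "segala_system f \<Longrightarrow> (\<And>x. h x \<in> Y) \<Longrightarrow> observations f h x b \<in> C0M Y"
  unfolding C0M_iff by (auto intro: observable.zero convex_observations observable_in_valuations)

definition obs_closed :: "('x, 'a) segala \<Rightarrow> ('x \<Rightarrow> 'y) \<Rightarrow> ('x \<Rightarrow> 'a list set \<Rightarrow> ('y \<Rightarrow> real) set) \<Rightarrow>
    'x \<Rightarrow> 'a list set \<Rightarrow> ('y \<Rightarrow> real) set \<Rightarrow> bool" where
  "obs_closed f h K x b L \<longleftrightarrow> ([] \<in> b \<longrightarrow> dirac (h x) \<in> L) \<and>
    (\<forall>(\<xi>, a)\<in>f x. \<forall>\<theta>. (\<forall>y. \<theta> y \<in> K y (lang_quot b a)) \<longrightarrow> bind \<xi> \<theta> \<in> L)"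

lemma obs_closedD:
  assumes "obs_closed f h K x b L"
  shows "[] \<in> b \<Longrightarrow> dirac (h x) \<in> L"
    and "(\<xi>, a) \<in> f x \<Longrightarrow> (\<And>y. \<theta> y \<in> K y (lang_quot b a)) \<Longrightarrow> bind \<xi> \<theta> \<in> L"
  using assms unfolding obs_closed_def by blast+

lemma obs_closed_antimono:
  assumes "obs_closed f h K x b L" "\<And>y a. K' y (lang_quot b a) \<subseteq> K y (lang_quot b a)"
  shows "obs_closed f h K' x b L"
proof -
  have "bind \<xi> \<theta> \<in> L" if "(\<xi>, a) \<in> f x" "\<forall>y. \<theta> y \<in> K' y (lang_quot b a)" for \<xi> a \<theta>
    using that assms(2) by (intro obs_closedD(2)[OF assms(1)]) auto
  then show ?thesis
    using obs_closedD(1)[OF assms(1)] by (auto simp: obs_closed_def)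
qed

lemma obs_closed_observations: "obs_closed f h (observations f h) x b (observations f h x b)"
  by (auto simp: obs_closed_def intro: observable.halt observable.step)

lemma observable_least:
  assumes K: "\<And>x b. b \<in> B \<Longrightarrow> K x b \<in> C0M Y" and quot: "\<And>b a. b \<in> B \<Longrightarrow> lang_quot b a \<in> B"
    and closed: "\<And>x b. b \<in> B \<Longrightarrow> obs_closed f h K x b (K x b)"
  shows "observable f h x b \<phi> \<Longrightarrow> b \<in> B \<Longrightarrow> \<phi> \<in> K x b"
proof (induction rule: observable.induct)
  case (zero x b)
  then show "0 \<in> K x b"
    using K[of b x] by (simp add: C0M_iff)
next
  case (halt b x)
  then show "dirac (h x) \<in> K x b"
    by (intro obs_closedD(1)[OF closed])
next
  case (step \<xi> a x b \<theta>)
  then show "bind \<xi> \<theta> \<in> K x b"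
    using quot by (intro obs_closedD(2)[OF closed step.hyps(1)] step.IH)
next
  case (convex x b \<phi> \<psi> s t)
  then show "s *\<^sub>R \<phi> + t *\<^sub>R \<psi> \<in> K x b"
    using K[of b x] unfolding C0M_iff by (intro convexD) auto
qed

section \<open>The operators of the monad\<close>

lemma label_in_kappa: "(\<xi>, a) \<in> S \<Longrightarrow> label \<xi> a \<in> kappa S"
  unfolding kappa_def
  by (rule CollectI, rule exI[of _ 1], rule exI[of _ "\<lambda>_. 1"], rule exI[of _ "\<lambda>_. \<xi>"],
      rule exI[of _ "\<lambda>_. a"]) (auto simp: label_def)

lemma kappa_subset_convex_hull: "kappa S \<subseteq> convex hull insert 0 ((\<lambda>(\<xi>, a). label \<xi> a) ` S)"
proof
  fix \<zeta> assume "\<zeta> \<in> kappa S"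
  then obtain n r \<xi>s as where S: "\<forall>i<(n::nat). (\<xi>s i, as i) \<in> S \<and> 0 \<le> r i" and r: "(\<Sum>i<n. r i) \<le> 1"
    and \<zeta>: "\<zeta> = (\<lambda>(x, a). \<Sum>i<n. r i * (if a = as i then 1 else 0) * \<xi>s i x)"
    unfolding kappa_def by blast
  have "\<zeta> = (\<Sum>i<n. r i *\<^sub>R label (\<xi>s i) (as i))"
    unfolding \<zeta> by (auto simp: sum_scaleR_fun_eq label_def fun_eq_iff intro!: sum.cong)
  also have "\<dots> \<in> convex hull insert 0 ((\<lambda>(\<xi>, a). label \<xi> a) ` S)"
    using S r by (intro convex_sum_le_one convex_convex_hull hull_inc) force+
  finally show "\<zeta> \<in> convex hull insert 0 ((\<lambda>(\<xi>, a). label \<xi> a) ` S)" .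
qed

lemma labels_subset_valuations:
  assumes "S \<subseteq> dists \<times> UNIV"
  shows "insert 0 ((\<lambda>(\<xi>, a). label \<xi> a) ` S) \<subseteq> valuations UNIV"
  using assms by (auto intro: label_in_valuations distsD(1))

lemma C_ext_eq_bind:
  assumes "S \<subseteq> valuations X"
  shows "C_ext g S = {bind \<zeta> \<theta> | \<zeta> \<theta>. \<zeta> \<in> S \<and> (\<forall>y. \<theta> y \<in> g y)}"
proof -
  have "(\<lambda>z. Sum_any (\<lambda>y. \<zeta> y * \<theta> y z)) = bind \<zeta> \<theta>" if "\<zeta> \<in> S" for \<zeta> \<theta>
    using that assms by (auto simp: fun_eq_iff bind_apply[of \<zeta>] bind_eq_Sum_any)
  then show ?thesis
    unfolding C_ext_def by (intro Collect_cong ex_cong1) auto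
qed

lemma C_ext_kappa_eq_bind:
  assumes "S \<subseteq> dists \<times> UNIV"
  shows "C_ext g (kappa S) = {bind \<zeta> \<theta> | \<zeta> \<theta>. \<zeta> \<in> kappa S \<and> (\<forall>p. \<theta> p \<in> g p)}"
proof (rule C_ext_eq_bind)
  show "kappa S \<subseteq> valuations UNIV"
    using kappa_subset_convex_hull
      convex_hull_subset_valuations[OF labels_subset_valuations[OF assms]]
    by (rule subset_trans)
qed

lemma bind_in_C_ext_kappa:
  assumes "S \<subseteq> dists \<times> UNIV" "(\<xi>, a) \<in> S" "\<And>p. 0 \<in> g p" "\<And>y. \<theta> y \<in> g (y, a)"
  shows "bind \<xi> \<theta> \<in> C_ext g (kappa S)"
proof -
  let ?\<theta> = "\<lambda>(y, c). if c = a then \<theta> y else 0"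
  have "\<forall>p. ?\<theta> p \<in> g p"
    using assms(3,4) by auto
  then have "bind (label \<xi> a) ?\<theta> \<in> C_ext g (kappa S)"
    unfolding C_ext_kappa_eq_bind[OF assms(1)] using label_in_kappa[OF assms(2)] by blast
  then show ?thesis
    by (simp add: bind_label)
qed

lemma C_ext_kappa_subset_iff:
  assumes S: "S \<subseteq> dists \<times> UNIV" and g: "\<And>p. 0 \<in> g p" and K: "convex K" "0 \<in> K"
  shows "C_ext g (kappa S) \<subseteq> K \<longleftrightarrow>
    (\<forall>(\<xi>, a)\<in>S. \<forall>\<theta>. (\<forall>y. \<theta> y \<in> g (y, a)) \<longrightarrow> bind \<xi> \<theta> \<in> K)"
proof
  assume "C_ext g (kappa S) \<subseteq> K"
  then show "\<forall>(\<xi>, a)\<in>S. \<forall>\<theta>. (\<forall>y. \<theta> y \<in> g (y, a)) \<longrightarrow> bind \<xi> \<theta> \<in> K"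
    using bind_in_C_ext_kappa[where g = g, OF S _ g] by blast
next
  assume step: "\<forall>(\<xi>, a)\<in>S. \<forall>\<theta>. (\<forall>y. \<theta> y \<in> g (y, a)) \<longrightarrow> bind \<xi> \<theta> \<in> K"
  have "bind \<zeta> \<theta> \<in> K" if \<zeta>: "\<zeta> \<in> kappa S" and \<theta>: "\<forall>p. \<theta> p \<in> g p" for \<zeta> \<theta>
  proof (rule bind_convex_hull[OF _ labels_subset_valuations[OF S] K(1)])
    show "\<zeta> \<in> convex hull insert 0 ((\<lambda>(\<xi>, a). label \<xi> a) ` S)"
      using \<zeta> kappa_subset_convex_hull by (rule subsetD[rotated])
    show "bind \<omega> \<theta> \<in> K" if "\<omega> \<in> insert 0 ((\<lambda>(\<xi>, a). label \<xi> a) ` S)" for \<omega>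
      using that step K(2) \<theta> by (auto simp: bind_label)
  qed
  then show "C_ext g (kappa S) \<subseteq> K"
    unfolding C_ext_kappa_eq_bind[OF S] by blast
qed

lemma obs_init_subset_iff:
  assumes "K \<in> C0M Y"
  shows "obs_init h b x \<subseteq> K \<longleftrightarrow> ([] \<in> b \<longrightarrow> dirac (h x) \<in> K)"
proof (cases "[] \<in> b")
  case True
  then have init: "obs_init h b x = {r *\<^sub>R dirac (h x) | r. 0 \<le> r \<and> r \<le> 1}"
    by (simp add: obs_init_def C_unit_def scaleR_fun_def)
  have "r *\<^sub>R dirac (h x) \<in> K" if "dirac (h x) \<in> K" "0 \<le> r" "r \<le> 1" for r
    using convexD_alt[of K 0 "dirac (h x)" r] that assms by (simp add: C0M_iff)
  moreover have "1 *\<^sub>R dirac (h x) \<in> obs_init h b x"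
    unfolding init by (intro CollectI exI[of _ 1]) simp
  ultimately show ?thesis
    using True init by auto
next
  case False
  then show ?thesis
    using assms by (simp add: obs_init_def C0M_iff zero_fun_def)
qed

lemma C_join_eq_convex_hull:
  assumes "M \<union> N \<subseteq> valuations Y"
  shows "C_join Y M N = convex hull insert 0 (M \<union> N)"
  unfolding C_join_def
proof (rule Least_equality)
  have "convex hull insert 0 (M \<union> N) \<subseteq> valuations Y"
    using assms by (intro convex_hull_subset_valuations) simp
  then show "convex hull insert 0 (M \<union> N) \<in> C0M Y \<and> M \<union> N \<subseteq> convex hull insert 0 (M \<union> N)"
    unfolding C0M_iff by (auto intro: hull_inc convex_convex_hull)
next
  fix K assume "K \<in> C0M Y \<and> M \<union> N \<subseteq> K"
  then show "convex hull insert 0 (M \<union> N) \<subseteq> K"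
    unfolding C0M_iff by (intro hull_minimal) auto
qed

lemma C_join_in_C0M:
  assumes "M \<union> N \<subseteq> valuations Y"
  shows "C_join Y M N \<in> C0M Y"
  unfolding C_join_eq_convex_hull[OF assms] C0M_iff
  using convex_hull_subset_valuations[of "insert 0 (M \<union> N)" Y] assms
  by (simp add: hull_inc convex_convex_hull)

lemma C_join_subset_iff:
  assumes "M \<union> N \<subseteq> valuations Y" "K \<in> C0M Y"
  shows "C_join Y M N \<subseteq> K \<longleftrightarrow> M \<subseteq> K \<and> N \<subseteq> K"
proof
  assume "C_join Y M N \<subseteq> K"
  then show "M \<subseteq> K \<and> N \<subseteq> K"
    unfolding C_join_eq_convex_hull[OF assms(1)] by (auto intro: hull_inc)
next
  assume "M \<subseteq> K \<and> N \<subseteq> K"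
  then show "C_join Y M N \<subseteq> K"
    unfolding C_join_eq_convex_hull[OF assms(1)] using assms(2)
    by (intro hull_minimal) (auto simp: C0M_iff)
qed

section \<open>Observations are the least solution\<close>

definition obs_op :: "'y set \<Rightarrow> ('x, 'a) segala \<Rightarrow> ('x \<Rightarrow> 'y) \<Rightarrow>
    ('x \<Rightarrow> 'a list set \<Rightarrow> ('y \<Rightarrow> real) set) \<Rightarrow> 'x \<Rightarrow> 'a list set \<Rightarrow> ('y \<Rightarrow> real) set" where
  "obs_op Y f h K x b =
    C_join Y (obs_init h b x) (C_ext (\<lambda>(y, a). K y (lang_quot b a)) (kappa (f x)))"

lemma obs_closed_iff:
  assumes "segala_system f" "\<And>y a. K y (lang_quot b a) \<in> C0M Y" "L \<in> C0M Y"
  shows "obs_closed f h K x b L \<longleftrightarrow>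
    obs_init h b x \<subseteq> L \<and> C_ext (\<lambda>(y, a). K y (lang_quot b a)) (kappa (f x)) \<subseteq> L"
proof -
  have "f x \<subseteq> dists \<times> UNIV" "\<And>p. 0 \<in> (case p of (y, a) \<Rightarrow> K y (lang_quot b a))" "convex L" "0 \<in> L"
    using assms by (auto simp: segala_system_def C0M_iff)
  then show ?thesis
    unfolding obs_closed_def obs_init_subset_iff[OF assms(3)] by (subst C_ext_kappa_subset_iff) auto
qed

lemma obs_closed_valuations:
  assumes segala: "segala_system f" and h: "\<And>x. h x \<in> Y" and K: "\<And>y a. K y (lang_quot b a) \<in> C0M Y"
  shows "obs_closed f h K x b (valuations Y)"
proof -
  have "bind \<xi> \<theta> \<in> valuations Y" if "(\<xi>, a) \<in> f x" "\<forall>y. \<theta> y \<in> K y (lang_quot b a)" for \<xi> a \<theta>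
  proof (rule bind_in_valuations[OF segala_system_valuations[OF segala that(1)]])
    show "\<theta> y \<in> valuations Y" for y
      using that(2) K[of y a] by (auto simp: C0M_iff)
  qed
  then show ?thesis
    using h by (auto simp: obs_closed_def intro: dirac_in_valuations)
qed

lemma
  assumes segala: "segala_system f" and h: "\<And>x. h x \<in> Y" and K: "\<And>y a. K y (lang_quot b a) \<in> C0M Y"
  shows obs_op_in_C0M: "obs_op Y f h K x b \<in> C0M Y"
    and obs_op_subset_iff: "L \<in> C0M Y \<Longrightarrow> obs_op Y f h K x b \<subseteq> L \<longleftrightarrow> obs_closed f h K x b L"
proof -
  have "valuations Y \<in> C0M Y"
    by (simp add: C0M_iff convex_valuations)
  then have "obs_init h b x \<union> C_ext (\<lambda>(y, a). K y (lang_quot b a)) (kappa (f x)) \<subseteq> valuations Y"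
    using obs_closed_valuations[of f h Y K b x] obs_closed_iff[of f K b Y "valuations Y" h x] assms
    by simp
  then show "obs_op Y f h K x b \<in> C0M Y"
    and "L \<in> C0M Y \<Longrightarrow> obs_op Y f h K x b \<subseteq> L \<longleftrightarrow> obs_closed f h K x b L"
    unfolding obs_op_def using obs_closed_iff[of f K b Y L h x] segala K
    by (simp_all add: C_join_in_C0M C_join_subset_iff)
qed

lemma obs_op_observations:
  assumes segala: "segala_system f" and h: "\<And>x. h x \<in> Y"
  shows "obs_op Y f h (observations f h) x b = observations f h x b"
proof
  let ?K = "obs_op Y f h (observations f h)"
  have in_C0M: "observations f h x b \<in> C0M Y" for x b
    using segala h by (rule observations_in_C0M)
  have op_in_C0M: "?K x b \<in> C0M Y" for x b
    using segala h in_C0M by (rule obs_op_in_C0M)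
  have op_subset_iff: "?K x b \<subseteq> L \<longleftrightarrow> obs_closed f h (observations f h) x b L"
    if "L \<in> C0M Y" for x b L
    using segala h in_C0M that by (rule obs_op_subset_iff)
  have op_subset: "?K x b \<subseteq> observations f h x b" for x b
    unfolding op_subset_iff[OF in_C0M] by (rule obs_closed_observations)
  then show "?K x b \<subseteq> observations f h x b" .
  have "obs_closed f h (observations f h) x b (?K x b)" for x b
    unfolding op_subset_iff[OF op_in_C0M, symmetric] by simp
  then have "obs_closed f h ?K x b (?K x b)" for x b
    using op_subset by (rule obs_closed_antimono)
  then show "observations f h x b \<subseteq> ?K x b"
    using observable_least[where B = UNIV and K = ?K and Y = Y] op_in_C0M by blast
qed

lemma obs_map_kappa:
  assumes segala: "segala_system f" and h: "\<And>x. h x \<in> Y" and quot: "\<And>b a. b \<in> B \<Longrightarrow> lang_quot b a \<in> B"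
  shows "obs_map B Y h (kappa \<circ> f) = (\<lambda>x. \<lambda>b\<in>B. observations f h x b)"
  unfolding obs_map_def comp_apply obs_op_def[symmetric]
proof (rule Least_equality)
  let ?O = "\<lambda>x. \<lambda>b\<in>B. observations f h x b"
  have "obs_op Y f h ?O x b = obs_op Y f h (observations f h) x b" if "b \<in> B" for x b
    using quot[OF that] by (simp add: obs_op_def)
  then show "(\<forall>x. ?O x \<in> B \<rightarrow>\<^sub>E C0M Y) \<and> (\<forall>x. \<forall>b\<in>B. ?O x b = obs_op Y f h ?O x b)"
    using observations_in_C0M[OF segala h] obs_op_observations[OF segala h] by auto
next
  fix K assume K: "(\<forall>x. K x \<in> B \<rightarrow>\<^sub>E C0M Y) \<and> (\<forall>x. \<forall>b\<in>B. K x b = obs_op Y f h K x b)"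
  then have in_C0M: "K x b \<in> C0M Y" if "b \<in> B" for x b
    using that by blast
  have "obs_closed f h K x b (K x b)" if "b \<in> B" for x b
    using obs_op_subset_iff[of f h Y K b "K x b" x] segala h in_C0M quot K that by simp
  then have "observations f h x b \<subseteq> K x b" if "b \<in> B" for x b
    using observable_least[where K = K and B = B] in_C0M quot that by blast
  moreover have "K x b = undefined" if "b \<notin> B" for x b
    using K that by (auto dest: PiE_arb)
  ultimately show "(\<lambda>x. \<lambda>b\<in>B. observations f h x b) \<le> K"
    by (simp add: le_fun_def restrict_def)
qed

section \<open>Weak bisimulations preserve observations\<close>

lemma observable_bind_idle:
  assumes "(\<xi>, c) \<in> idle \<tau> f x" "lang_quot b \<tau> = b" "\<And>y. observable f h y (lang_quot b c) (\<theta> y)"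
  shows "observable f h x b (bind \<xi> \<theta>)"
proof (cases "(\<xi>, c) \<in> f x")
  case True
  then show ?thesis
    using assms(3) by (intro observable.step)
next
  case False
  then have "\<xi> = dirac x" "c = \<tau>"
    using assms(1) by (auto simp: idle_def)
  then show ?thesis
    using assms(2,3) by simp
qed

lemma observable_bind_residual_steps:
  assumes segala: "segala_system f" and b: "b \<in> weak_pattern \<tau>"
    and \<zeta>: "\<zeta> \<in> convex hull residual_steps \<tau> (idle \<tau> f) x a"
    and \<kappa>: "\<And>y c d. (c, d) \<in> residuals \<tau> a \<Longrightarrow> observable f h y (lang_quot b c) (\<kappa> (y, d))"
  shows "observable f h x b (bind \<zeta> \<kappa>)"
proof -
  have "bind \<alpha> \<kappa> \<in> observations f h x b" if "\<alpha> \<in> residual_steps \<tau> (idle \<tau> f) x a" for \<alpha>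
  proof -
    from that obtain \<beta> c d where \<alpha>: "\<alpha> = label \<beta> d" and \<beta>: "(\<beta>, c) \<in> idle \<tau> f x"
      and residual: "(c, d) \<in> residuals \<tau> a"
      by (auto simp: residual_steps_def)
    have "observable f h x b (bind \<beta> (\<lambda>y. \<kappa> (y, d)))"
      using \<beta> lang_quot_silent[OF b] \<kappa>[OF residual] by (rule observable_bind_idle)
    then show ?thesis
      by (simp add: \<alpha> bind_label)
  qed
  then have "bind \<zeta> \<kappa> \<in> observations f h x b"
    using residual_steps_subset_valuations[OF segala_system_idle[OF segala]]
    by (intro bind_convex_hull[OF \<zeta> _ convex_observations])
  then show ?thesis by simp
qed

lemma observable_bind_weak_trans:
  assumes segala: "segala_system f"
  shows "weak_trans \<tau> (idle \<tau> f) n x a \<xi> \<Longrightarrow> b \<in> weak_pattern \<tau> \<Longrightarrow>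
    (\<And>y. observable f h y (lang_quot b a) (\<theta> y)) \<Longrightarrow> observable f h x b (bind \<xi> \<theta>)"
proof (induction n arbitrary: x a \<xi> b)
  case 0
  then show ?case by (simp add: lang_quot_silent)
next
  case (Suc n)
  note segala_idle = segala_system_idle[OF segala, of \<tau>]
  obtain \<zeta> \<omega> where \<zeta>: "\<zeta> \<in> convex hull residual_steps \<tau> (idle \<tau> f) x a" and \<xi>: "\<xi> = bind \<zeta> \<omega>"
    and \<omega>: "\<And>z. z \<in> supp \<zeta> \<Longrightarrow> \<omega> z \<in> weak_trans_set \<tau> (idle \<tau> f) n z"
    using Suc.prems(1) unfolding weak_trans_Suc_iff[OF segala_idle] by (elim bexE bind_setE) auto
  define \<kappa> where "\<kappa> z = (if z \<in> supp \<zeta> then bind (\<omega> z) \<theta> else 0)" for z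
  have "finite (supp (\<omega> z))" if "z \<in> supp \<zeta>" for z
    using \<omega>[OF that]
    by (cases z) (auto intro: finite_supp_valuation weak_trans_in_valuations[OF segala_idle])
  then have bind_eq: "bind \<xi> \<theta> = bind \<zeta> \<kappa>"
    unfolding \<xi> \<kappa>_def by (simp add: bind_assoc cong: bind_cong)
  show ?case
    unfolding bind_eq
  proof (rule observable_bind_residual_steps[OF segala Suc.prems(2) \<zeta>])
    fix y c d assume residual: "(c, d) \<in> residuals \<tau> a"
    show "observable f h y (lang_quot b c) (\<kappa> (y, d))"
    proof (cases "(y, d) \<in> supp \<zeta>")
      case True
      then show ?thesis
        using Suc.IH[of y d "\<omega> (y, d)" "lang_quot b c"] \<omega>[OF True] Suc.prems(2,3)
        by (simp add: \<kappa>_def lang_quot_in_weak_pattern lang_quot_residual[OF _ residual])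
    qed (simp add: \<kappa>_def observable.zero)
  qed
qed

definition weak_bisim_map :: "'a \<Rightarrow> ('x, 'a) segala \<Rightarrow> ('x \<Rightarrow> 'y) \<Rightarrow> bool" where
  "weak_bisim_map \<tau> f h \<longleftrightarrow> (\<forall>x y \<xi> a. h x = h y \<longrightarrow> (\<xi>, a) \<in> f x \<longrightarrow>
    pushforward h \<xi> \<in> pushforward h ` weak_steps \<tau> f y a)"

lemma weak_bisim_map_imp_observable:
  assumes segala: "segala_system f" and bisim: "weak_bisim_map \<tau> f h"
  shows "observable f h x b \<phi> \<Longrightarrow> b \<in> weak_pattern \<tau> \<Longrightarrow> h x = h y \<Longrightarrow> observable f h y b \<phi>"
proof (induction arbitrary: y rule: observable.induct)
  case (zero x b)
  show ?case by (rule observable.zero)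
next
  case (halt b x)
  then show ?case using observable.halt[of b f h y] by simp
next
  case (step \<xi> a x b \<theta>)
  obtain n \<xi>' where \<xi>': "weak_trans \<tau> (idle \<tau> f) n y a \<xi>'"
    and pushforward_eq: "pushforward h \<xi> = pushforward h \<xi>'"
    using bisim step.hyps step.prems(2) unfolding weak_bisim_map_def weak_steps_def by blast
  define M where "M z = (\<Inter>y\<in>{y. h y = z}. observations f h y (lang_quot b a))" for z
  have M: "convex (M z)" "0 \<in> M z" for z
    unfolding M_def by (auto intro: convex_INT convex_observations observable.zero)
  have "\<theta> z \<in> M (h z)" for z
    unfolding M_def using step.IH lang_quot_in_weak_pattern[OF step.prems(1)] by auto
  then have "bind \<xi> \<theta> \<in> bind_set (pushforward h \<xi>') M"
    unfolding pushforward_eq[symmetric] using M(1) segala_system_valuations[OF segala step.hyps(1)]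
    by (intro bind_in_bind_set_pushforward)
  then obtain \<psi> where \<psi>: "bind \<xi> \<theta> = bind (pushforward h \<xi>') \<psi>" "\<And>z. \<psi> z \<in> M z"
    using M(2) by (elim bind_set_totalE) auto
  have "observable f h z (lang_quot b a) (\<psi> (h z))" for z
    using \<psi>(2)[of "h z"] by (simp add: M_def)
  then show ?case
    unfolding \<psi>(1) bind_pushforward
    by (intro observable_bind_weak_trans[OF segala \<xi>' step.prems(1)])
next
  case (convex x b \<phi> \<psi> s t)
  then show ?case by (intro observable.convex) auto
qed

section \<open>Observations of total mass one\<close>

lemma observable_empty:
  assumes "observable f h x {} \<phi>"
  shows "\<phi> = 0"
proof -
  have "{0} \<in> C0M UNIV"
    by (simp add: C0M_iff)
  moreover have "obs_closed f h (\<lambda>_ _. {0}) x {} {0}" for x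
    by (simp add: obs_closed_def bind_def)
  ultimately show ?thesis
    using observable_least[of "{{}}" "\<lambda>_ _. {0}" UNIV f h x "{}" \<phi>] assms by simp
qed

lemma Sum_any_observable_le_one:
  assumes segala: "segala_system f"
  shows "observable f h x b \<phi> \<Longrightarrow> Sum_any \<phi> \<le> 1"
proof (induction rule: observable.induct)
  case (zero x b)
  show ?case by (simp add: Sum_any_eq_bind)
next
  case (halt b x)
  show ?case by (simp add: Sum_any_eq_bind)
next
  case (step \<xi> a x b \<theta>)
  have "bind \<xi> (\<lambda>y. Sum_any (\<theta> y)) \<le> 1"
    using step.IH by (rule bind_dist_le[OF segala_system_dists[OF segala step.hyps(1)]])
  then show "Sum_any (bind \<xi> \<theta>) \<le> 1"
    using finite_supp_observable[OF segala step.hyps(2)] by (simp add: Sum_any_bind)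
next
  case (convex x b \<phi> \<psi> s t)
  have "Sum_any (s *\<^sub>R \<phi> + t *\<^sub>R \<psi>) = s * Sum_any \<phi> + t * Sum_any \<psi>"
    using convex.hyps by (intro Sum_any_scaleR_add_scaleR finite_supp_observable[OF segala])
  also have "\<dots> \<le> 1"
    using convex.IH convex.hyps by (intro convex_bound_le)
  finally show "Sum_any (s *\<^sub>R \<phi> + t *\<^sub>R \<psi>) \<le> 1" .
qed

lemma Sum_any_bind_observable_eq_oneD:
  assumes segala: "segala_system f" and \<xi>: "(\<xi>, a) \<in> f x" and \<theta>: "\<And>y. observable f h y b (\<theta> y)"
    and total: "Sum_any (bind \<xi> \<theta>) = 1" and y: "y \<in> supp \<xi>"
  shows "Sum_any (\<theta> y) = 1"
proof (rule bind_dist_eq_upper_boundD[OF segala_system_dists[OF segala \<xi>] _ _ y])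
  show "bind \<xi> (\<lambda>y. Sum_any (\<theta> y)) = 1"
    using total finite_supp_observable[OF segala \<theta>] by (simp add: Sum_any_bind)
  show "Sum_any (\<theta> z) \<le> 1" for z
    using \<theta> by (rule Sum_any_observable_le_one[OF segala])
qed

lemma Sum_any_convex_observable_eq_oneD:
  assumes segala: "segala_system f" and obs: "observable f h x b \<phi>" "observable f h x b \<psi>"
    and weights: "0 < s" "0 < t" "s + t = 1" and total: "Sum_any (s *\<^sub>R \<phi> + t *\<^sub>R \<psi>) = 1"
  shows "Sum_any \<phi> = 1" "Sum_any \<psi> = 1"
proof -
  have "s * Sum_any \<phi> + t * Sum_any \<psi> = Sum_any (s *\<^sub>R \<phi> + t *\<^sub>R \<psi>)"
    using obs by (intro Sum_any_scaleR_add_scaleR[symmetric] finite_supp_observable[OF segala])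
  also have "\<dots> = 1"
    by (rule total)
  finally show "Sum_any \<phi> = 1" "Sum_any \<psi> = 1"
    using convex_combination_eq_upper_boundD[OF _ weights(3,1,2)]
      Sum_any_observable_le_one[OF segala obs(1)] Sum_any_observable_le_one[OF segala obs(2)]
    by blast+
qed

lemma observable_total_one_imp_pushforward:
  assumes segala: "segala_system f"
  shows "observable f h x b \<phi> \<Longrightarrow> b = weak_lang \<tau> a \<Longrightarrow> Sum_any \<phi> = 1 \<Longrightarrow>
    \<phi> \<in> pushforward h ` weak_steps \<tau> f x a"
proof (induction arbitrary: a rule: observable.induct)
  case (zero x b)
  then show ?case by (simp add: Sum_any_eq_bind)
next
  case (halt b x)
  then have "a = \<tau>" "dirac (h x) = pushforward h (dirac x)"
    by (simp_all add: pushforward_def)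
  then show ?case
    using dirac_in_weak_steps by fastforce
next
  case (step \<xi> c x b \<theta>)
  have total: "Sum_any (\<theta> y) = 1" if "y \<in> supp \<xi>" for y
    using segala step.hyps step.prems(2) that by (rule Sum_any_bind_observable_eq_oneD)
  obtain y where y: "y \<in> supp \<xi>"
    using distsD(2)[OF segala_system_dists[OF segala step.hyps(1)]]
    by (fastforce simp: Sum_any_eq_bind bind_def)
  have "lang_quot b c \<noteq> {}"
    using observable_empty[of f h y "\<theta> y"] step.hyps(2)[of y] total[OF y]
    by (auto simp: Sum_any_eq_bind)
  then obtain d where residual: "(c, d) \<in> residuals \<tau> a" and quot: "lang_quot b c = weak_lang \<tau> d"
    unfolding step.prems(1) by (rule lang_quot_weak_lang_nonemptyE)
  show ?case
    using segala step.hyps(1) residual step.IH[OF quot total]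
    by (rule bind_in_pushforward_weak_steps)
next
  case (convex x b \<phi> \<psi> s t)
  consider "s = 0" "t = 1" | "s = 1" "t = 0" | "0 < s" "0 < t"
    using convex.hyps by linarith
  then show ?case
  proof cases
    case 3
    then have "Sum_any \<phi> = 1" "Sum_any \<psi> = 1"
      using Sum_any_convex_observable_eq_oneD[OF segala convex.hyps(1,2)] convex.hyps(5)
        convex.prems(2) by blast+
    then show ?thesis
      using convex.IH convex.prems(1) convex.hyps
      by (intro convexD[OF convex_pushforward_image[OF convex_weak_steps[OF segala]
              weak_steps_subset_valuations[OF segala]]])
  qed (use convex.IH convex.prems in auto)
qed

section \<open>Bisimulations as kernels of maps\<close>

lemma weak_bisim_map_iff_observations_eq:
  assumes segala: "segala_system f"
  shows "weak_bisim_map \<tau> f h \<longleftrightarrow>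
    (\<forall>x y. h x = h y \<longrightarrow> (\<forall>b\<in>weak_pattern \<tau>. observations f h x b = observations f h y b))"
    (is "_ \<longleftrightarrow> ?observations_eq")
proof
  assume "weak_bisim_map \<tau> f h"
  then show ?observations_eq
    using weak_bisim_map_imp_observable[OF segala] by (metis Collect_cong)
next
  assume observations_eq: ?observations_eq
  have "pushforward h \<xi> \<in> pushforward h ` weak_steps \<tau> f y a"
    if "h x = h y" "(\<xi>, a) \<in> f x" for x y \<xi> a
  proof (rule observable_total_one_imp_pushforward[OF segala _ refl])
    have "observable f h z (lang_quot (weak_lang \<tau> a) a) (dirac (h z))" for z
      by (rule observable.halt) (simp add: lang_quot_weak_lang)
    with that(2) have "observable f h x (weak_lang \<tau> a) (pushforward h \<xi>)"
      unfolding pushforward_def by (rule observable.step)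
    moreover have "weak_lang \<tau> a \<in> weak_pattern \<tau>"
      by (simp add: weak_pattern_eq)
    ultimately show "observable f h y (weak_lang \<tau> a) (pushforward h \<xi>)"
      using observations_eq that(1) by blast
    show "Sum_any (pushforward h \<xi>) = 1"
      using distsD(2)[OF segala_system_dists[OF segala that(2)]] by (simp add: Sum_any_pushforward)
  qed
  then show "weak_bisim_map \<tau> f h"
    unfolding weak_bisim_map_def by blast
qed

lemma mass_eq_bind:
  assumes "finite (supp \<xi>)"
  shows "mass \<xi> C = bind \<xi> (\<lambda>x. if x \<in> C then 1 else 0)"
  unfolding mass_def bind_eq_Sum_any[OF assms] by (rule arg_cong[of _ _ Sum_any]) auto

lemma pushforward_class_apply:
  assumes "equiv UNIV E" "finite (supp \<xi>)"
  shows "pushforward (\<lambda>x. E `` {x}) \<xi> C = (if C \<in> UNIV // E then mass \<xi> C else 0)"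
proof (cases "C \<in> UNIV // E")
  case True
  then have "C = E `` {x} \<longleftrightarrow> x \<in> C" for x
    using assms(1)
    by (metis Image_singleton_iff UNIV_I equiv_class_eq_iff equiv_class_self quotientE)
  then show ?thesis
    using True assms(2) by (simp add: pushforward_def bind_apply[of \<xi>] mass_eq_bind dirac_def)
next
  case False
  then have "C \<noteq> E `` {x}" for x
    by (auto intro: quotientI)
  then show ?thesis
    unfolding pushforward_def bind_apply[of \<xi>] using False by (simp add: dirac_def bind_def)
qed

lemma pushforward_class_eq_iff:
  assumes "equiv UNIV E" "finite (supp \<xi>)" "finite (supp \<xi>')"
  shows "pushforward (\<lambda>x. E `` {x}) \<xi> = pushforward (\<lambda>x. E `` {x}) \<xi>' \<longleftrightarrow>
    (\<forall>C\<in>UNIV // E. mass \<xi> C = mass \<xi>' C)"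
  using assms by (auto simp: fun_eq_iff pushforward_class_apply)

lemma weak_prob_bisim_iff:
  assumes segala: "segala_system f" and equiv: "equiv UNIV E"
  shows "weak_prob_bisim \<tau> f E \<longleftrightarrow> weak_bisim_map \<tau> f (\<lambda>x. E `` {x})"
proof -
  have "(\<exists>n \<xi>'. weak_trans \<tau> (idle \<tau> f) n y a \<xi>' \<and> (\<forall>C\<in>UNIV // E. mass \<xi> C = mass \<xi>' C)) \<longleftrightarrow>
      pushforward (\<lambda>x. E `` {x}) \<xi> \<in> pushforward (\<lambda>x. E `` {x}) ` weak_steps \<tau> f y a"
    if "(\<xi>, a) \<in> f x" for x y \<xi> a
    using pushforward_class_eq_iff[OF equiv
        finite_supp_valuation[OF segala_system_valuations[OF segala that]]]
      finite_supp_valuation[OF weak_trans_in_valuations[OF segala_system_idle[OF segala]]]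
    unfolding weak_steps_def by (simp add: image_iff)
  then show ?thesis
    unfolding weak_prob_bisim_def weak_bisim_map_def eq_equiv_class_iff[OF equiv UNIV_I UNIV_I]
    by blast
qed

lemma restrict_eq_iff: "restrict F B = restrict G B \<longleftrightarrow> (\<forall>b\<in>B. F b = G b)"
  by (metis restrict_apply' restrict_ext)

lemma obs_bisim_iff:
  assumes segala: "segala_system f" and equiv: "equiv UNIV E"
  shows "obs_bisim (weak_pattern \<tau>) (kappa \<circ> f) E \<longleftrightarrow> (\<forall>x y. E `` {x} = E `` {y} \<longrightarrow>
    (\<forall>b\<in>weak_pattern \<tau>. observations f (\<lambda>x. E `` {x}) x b = observations f (\<lambda>x. E `` {x}) y b))"
proof -
  have "obs_map (weak_pattern \<tau>) (UNIV // E) (\<lambda>x. E `` {x}) (kappa \<circ> f) =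
      (\<lambda>x. \<lambda>b\<in>weak_pattern \<tau>. observations f (\<lambda>x. E `` {x}) x b)"
    by (intro obs_map_kappa segala quotientI UNIV_I lang_quot_in_weak_pattern)
  then show ?thesis
    unfolding obs_bisim_def eq_equiv_class_iff[OF equiv UNIV_I UNIV_I]
    by (simp add: restrict_eq_iff)
qed

theorem theorem25:
  fixes f :: "'x \<Rightarrow> (('x \<Rightarrow> real) \<times> 'a) set" and \<tau> :: 'a and E :: "('x \<times> 'x) set"
  assumes "segala_system f"
    and "equiv UNIV E"
  shows "weak_prob_bisim \<tau> f E \<longleftrightarrow> obs_bisim (weak_pattern \<tau>) (kappa \<circ> f) E"
  unfolding weak_prob_bisim_iff[OF assms] obs_bisim_iff[OF assms]
  by (rule weak_bisim_map_iff_observations_eq[OF assms(1)])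

end
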